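(* Let $G$ be a finite group. The $\mathbb{Z}$-algebra $\mathbb{Z}G/\mathbb{Z}\left(\sum_{x\in G}x\right)$ is symmetric if and only if $G$ is cyclic.
   Context: For a commutative ring $R$, an $R$-algebra $A$ is symmetric if $A$ is finitely generated projective as an $R$-module and $A\cong\mathrm{Hom}_{R}(A,R)$ as $A$-$A$-bimodules. *)

theory Defs
  imports "HOL-Algebra.Algebra"
begin

section \<open>Associative algebras over a commutative ring\<close>

text \<open>The library locale \<^locale>\<open>algebra\<close> only covers commutative algebras.\<close>

locale assoc_algebra = module + ring M +
  assumes smult_assoc_left:
      "\<lbrakk>a \<in> carrier R; x \<in> carrier M; y \<in> carrier M\<rbrakk> \<Longrightarrow>
        (a \<odot>\<^bsub>M\<^esub> x) \<otimes>\<^bsub>M\<^esub> y = a \<odot>\<^bsub>M\<^esub> (x \<otimes>\<^bsub>M\<^esub> y)"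
    and smult_assoc_right:
      "\<lbrakk>a \<in> carrier R; x \<in> carrier M; y \<in> carrier M\<rbrakk> \<Longrightarrow>
        x \<otimes>\<^bsub>M\<^esub> (a \<odot>\<^bsub>M\<^esub> y) = a \<odot>\<^bsub>M\<^esub> (x \<otimes>\<^bsub>M\<^esub> y)"

text \<open>For a two-sided ideal \<open>I\<close> stable under scalars, the scalar multiplication below is
  \<open>r \<odot> (I + x) = I + r \<odot> x\<close>; the union makes the definition independent of representatives,
  as in \<^const>\<open>rcoset_mult\<close>.\<close>

definition quotient_algebra ::
    "('r, 'm, 'e) module_scheme \<Rightarrow> 'm set \<Rightarrow> ('r, 'm set) module"
  where "quotient_algebra A I =
    \<lparr>carrier = carrier (A Quot I), monoid.mult = monoid.mult (A Quot I), one = one (A Quot I),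
     ring.zero = ring.zero (A Quot I), ring.add = ring.add (A Quot I),
     smult = (\<lambda>r C. \<Union>x\<in>C. I +>\<^bsub>A\<^esub> (r \<odot>\<^bsub>A\<^esub> x))\<rparr>"


section \<open>Linear maps and finitely generated projective modules\<close>

definition linear_maps ::
    "('r, 'c) ring_scheme \<Rightarrow> ('r, 'm, 'd) module_scheme \<Rightarrow> ('r, 'n, 'e) module_scheme
      \<Rightarrow> ('m \<Rightarrow> 'n) set"
  where "linear_maps R M N =
    {f \<in> carrier M \<rightarrow>\<^sub>E carrier N.
       (\<forall>x\<in>carrier M. \<forall>y\<in>carrier M. f (x \<oplus>\<^bsub>M\<^esub> y) = f x \<oplus>\<^bsub>N\<^esub> f y) \<and>
       (\<forall>r\<in>carrier R. \<forall>x\<in>carrier M. f (r \<odot>\<^bsub>M\<^esub> x) = r \<odot>\<^bsub>N\<^esub> f x)}"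

definition module_isomorphic ::
    "('r, 'c) ring_scheme \<Rightarrow> ('r, 'm, 'd) module_scheme \<Rightarrow> ('r, 'n, 'e) module_scheme \<Rightarrow> bool"
  where "module_isomorphic R M N \<longleftrightarrow>
    (\<exists>f\<in>linear_maps R M N. bij_betw f (carrier M) (carrier N))"

definition finitely_generated_module ::
    "('r, 'c) ring_scheme \<Rightarrow> ('r, 'm, 'd) module_scheme \<Rightarrow> bool"
  where "finitely_generated_module R M \<longleftrightarrow>
    (\<exists>S. finite S \<and> S \<subseteq> carrier M \<and>
      (\<forall>x\<in>carrier M. \<exists>c\<in>S \<rightarrow> carrier R. x = (\<Oplus>\<^bsub>M\<^esub>s\<in>S. c s \<odot>\<^bsub>M\<^esub> s)))"

text \<open>The free module of finitely supported functions \<open>I \<rightarrow> R\<close>. A \<^typ>\<open>('r, 'm) module\<close> record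
  also carries the fields \<^const>\<open>monoid.mult\<close> and \<^const>\<open>one\<close>,
  which play no role for a mere module.\<close>

definition free_module :: "('r, 'c) ring_scheme \<Rightarrow> 'i set \<Rightarrow> ('r, 'i \<Rightarrow> 'r) module"
  where "free_module R I =
    \<lparr>carrier = {f \<in> I \<rightarrow>\<^sub>E carrier R. finite {i \<in> I. f i \<noteq> \<zero>\<^bsub>R\<^esub>}},
     monoid.mult = undefined, one = undefined,
     ring.zero = (\<lambda>i\<in>I. \<zero>\<^bsub>R\<^esub>),
     ring.add = (\<lambda>f g. \<lambda>i\<in>I. f i \<oplus>\<^bsub>R\<^esub> g i),
     smult = (\<lambda>r f. \<lambda>i\<in>I. r \<otimes>\<^bsub>R\<^esub> f i)\<rparr>"

text \<open>Projective means isomorphic to a direct summand of a free module. Taking the index set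
  inside the type of \<open>M\<close> is no restriction: if \<open>M\<close> is a direct summand of any free module, then
  the canonical surjection from the free module on \<open>carrier M\<close> onto \<open>M\<close> splits.\<close>

definition projective_module ::
    "('r, 'c) ring_scheme \<Rightarrow> ('r, 'm, 'd) module_scheme \<Rightarrow> bool"
  where "projective_module R M \<longleftrightarrow>
    (\<exists>(I :: 'm set) P Q. let F = free_module R I in
       submodule P R F \<and> submodule Q R F \<and>
       P \<inter> Q = {\<zero>\<^bsub>F\<^esub>} \<and> P <+>\<^bsub>F\<^esub> Q = carrier F \<and>
       module_isomorphic R M (F\<lparr>carrier := P\<rparr>))"


section \<open>Bimodules and symmetric algebras\<close>

record ('a, 'm) bimodule = "'m ring" +
  lact :: "'a \<Rightarrow> 'm \<Rightarrow> 'm"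
  ract :: "'m \<Rightarrow> 'a \<Rightarrow> 'm"

text \<open>Isomorphism of \<open>A\<close>-\<open>A\<close>-bimodules. Linearity over the ground ring of an algebra \<open>A\<close> is
  contained in the compatibility with the action of \<open>A\<close>.\<close>

definition bimodule_isomorphic ::
    "('a, 'c) ring_scheme \<Rightarrow> ('a, 'm, 'd) bimodule_scheme \<Rightarrow> ('a, 'n, 'e) bimodule_scheme \<Rightarrow> bool"
  where "bimodule_isomorphic A M N \<longleftrightarrow>
    (\<exists>f. bij_betw f (carrier M) (carrier N) \<and>
       (\<forall>x\<in>carrier M. \<forall>y\<in>carrier M. f (x \<oplus>\<^bsub>M\<^esub> y) = f x \<oplus>\<^bsub>N\<^esub> f y) \<and>
       (\<forall>a\<in>carrier A. \<forall>x\<in>carrier M. f (lact M a x) = lact N a (f x)) \<and>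
       (\<forall>a\<in>carrier A. \<forall>x\<in>carrier M. f (ract M x a) = ract N (f x) a))"

definition regular_bimodule :: "('a, 'c) ring_scheme \<Rightarrow> ('a, 'a) bimodule"
  where "regular_bimodule A =
    \<lparr>carrier = carrier A, monoid.mult = monoid.mult A, one = one A, ring.zero = ring.zero A, ring.add = ring.add A,
     lact = monoid.mult A, ract = monoid.mult A\<rparr>"

definition regular_module :: "('r, 'c) ring_scheme \<Rightarrow> ('r, 'r) module"
  where "regular_module R =
    \<lparr>carrier = carrier R, monoid.mult = monoid.mult R, one = one R, ring.zero = ring.zero R, ring.add = ring.add R,
     smult = monoid.mult R\<rparr>"

text \<open>\<open>Hom\<^sub>R(A, R)\<close> with \<open>(a f)(x) = f (x a)\<close> and \<open>(f a)(x) = f (a x)\<close>.\<close>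

definition dual_bimodule ::
    "('r, 'c) ring_scheme \<Rightarrow> ('r, 'a, 'd) module_scheme \<Rightarrow> ('a, 'a \<Rightarrow> 'r) bimodule"
  where "dual_bimodule R A =
    \<lparr>carrier = linear_maps R A (regular_module R),
     monoid.mult = undefined, one = undefined,
     ring.zero = (\<lambda>x\<in>carrier A. \<zero>\<^bsub>R\<^esub>),
     ring.add = (\<lambda>f g. \<lambda>x\<in>carrier A. f x \<oplus>\<^bsub>R\<^esub> g x),
     lact = (\<lambda>a f. \<lambda>x\<in>carrier A. f (x \<otimes>\<^bsub>A\<^esub> a)),
     ract = (\<lambda>f a. \<lambda>x\<in>carrier A. f (a \<otimes>\<^bsub>A\<^esub> x))\<rparr>"

definition symmetric_algebra ::
    "('r, 'c) ring_scheme \<Rightarrow> ('r, 'a, 'd) module_scheme \<Rightarrow> bool"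
  where "symmetric_algebra R A \<longleftrightarrow>
    assoc_algebra R A \<and> finitely_generated_module R A \<and> projective_module R A \<and>
    bimodule_isomorphic A (regular_bimodule A) (dual_bimodule R A)"


section \<open>Group algebras\<close>

definition group_basis ::
    "('r, 'c) ring_scheme \<Rightarrow> ('g, 'e) monoid_scheme \<Rightarrow> 'g \<Rightarrow> 'g \<Rightarrow> 'r"
  where "group_basis R G g = (\<lambda>x\<in>carrier G. if x = g then \<one>\<^bsub>R\<^esub> else \<zero>\<^bsub>R\<^esub>)"

text \<open>The coefficient of \<open>x\<close> in \<open>f h\<close> is the sum of \<open>f(y) h(z)\<close> over the pairs with \<open>y z = x\<close>.\<close>

definition group_algebra ::
    "('r, 'c) ring_scheme \<Rightarrow> ('g, 'e) monoid_scheme \<Rightarrow> ('r, 'g \<Rightarrow> 'r) module"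
  where "group_algebra R G = (free_module R (carrier G))
    \<lparr>monoid.mult := (\<lambda>f h. \<lambda>x\<in>carrier G.
       \<Oplus>\<^bsub>R\<^esub>y\<in>{y \<in> carrier G. f y \<noteq> \<zero>\<^bsub>R\<^esub>}. f y \<otimes>\<^bsub>R\<^esub> h (inv\<^bsub>G\<^esub> y \<otimes>\<^bsub>G\<^esub> x)),
     one := group_basis R G \<one>\<^bsub>G\<^esub>\<rparr>"

definition group_sum ::
    "('r, 'c) ring_scheme \<Rightarrow> ('g, 'e) monoid_scheme \<Rightarrow> 'g \<Rightarrow> 'r"
  where "group_sum R G = (\<Oplus>\<^bsub>group_algebra R G\<^esub>x\<in>carrier G. group_basis R G x)"

definition scalar_multiples ::
    "('r, 'c) ring_scheme \<Rightarrow> ('r, 'm, 'd) module_scheme \<Rightarrow> 'm \<Rightarrow> 'm set"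
  where "scalar_multiples R M x = {r \<odot>\<^bsub>M\<^esub> x |r. r \<in> carrier R}"

end

theory Submission
  imports Defs
begin

text \<open>
  Write \<open>A\<close> for the group ring modulo the multiples of \<open>\<sigma> = \<Sum>x\<close>. The classes of the group elements
  other than \<open>1\<close> form a basis of \<open>A\<close>, so for every finite \<open>G\<close> the question is only whether \<open>A\<close> and its
  dual are isomorphic bimodules. A functional on \<open>A\<close> is an integer function on \<open>G\<close> of sum zero.

  A bimodule isomorphism from \<open>A\<close> to its dual is determined by the image \<open>\<Lambda>\<close> of \<open>1\<close>, and linearity on both
  sides gives \<open>\<Lambda>(ab) = \<Lambda>(ba)\<close>. Hence \<open>c(g) = \<Lambda>(g)\<close> is a class function of sum zero, and
  \<open>z = \<Sum>c(g\<inverse>) g\<close> is a central element of augmentation zero. Surjectivity of the isomorphism says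
  precisely that every element of augmentation zero is a multiple of \<open>z\<close>
  (\<open>cyclic_if_symmetric\<close>). So the theorem reduces to a statement about group rings: if the
  augmentation ideal is generated by one central element \<open>z\<close>, then \<open>G\<close> is cyclic.

  Commutativity comes first. Every element is an integer plus a multiple of \<open>z\<close>, and writing
  \<open>u = s + u'z\<close>, \<open>v = t + v'z\<close> gives \<open>uv - vu = (u'v' - v'u')z\<^sup>2\<close>; by iteration all commutators lie in
  the ideal of every power of \<open>z\<close>. Modulo \<open>N = |G|\<close> there are only finitely many group ring elements,
  so \<open>z\<^sup>n = z\<^sup>n\<^sup>+\<^sup>k\<close> for some \<open>n\<close> and \<open>k > 0\<close>, and \<open>w = 1 - z\<^sup>k\<close> kills \<open>z\<^sup>n\<close>, hence all
  commutators. Applied to \<open>xy - yx\<close>, this says that modulo \<open>N\<close> the function \<open>w\<close> is invariant under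
  translation by \<open>(xy)\<inverse>yx\<close>. Let \<open>H\<close> be the group of all translations with that property. Summing over
  its cosets shows that \<open>|H|\<close> divides the augmentation of \<open>w\<close>, which is \<open>1\<close>, so \<open>xy = yx\<close>.

  For commutative \<open>G\<close> the product \<open>\<phi>(f) = \<Prod>x\<^bsup>f(x)\<^esup>\<close> turns sums into products. Since \<open>z\<close> has
  augmentation zero, \<open>\<phi>(az)\<close> is the power of \<open>\<phi>(z)\<close> with exponent the augmentation of \<open>a\<close>. As
  \<open>g = \<phi>(g - 1)\<close> and \<open>g - 1\<close> is a multiple of \<open>z\<close>, the element \<open>\<phi>(z)\<close> generates \<open>G\<close>.

  Conversely, if \<open>g\<close> generates \<open>G\<close>, the functional \<open>f \<mapsto> f(1) - f(g)\<close> induces an isomorphism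
  (\<open>symmetric_if_cyclic\<close>). It is bijective because a function on a finite cyclic group is determined
  up to a constant by its differences along \<open>g\<close>, and every function of sum zero is such a difference
  (\<open>discrete_antiderivative\<close>).
\<close>

section \<open>Quotients of algebras by scalar-stable ideals\<close>

lemma quotient_algebra_simps:
  "carrier (quotient_algebra A I) = a_rcosets\<^bsub>A\<^esub> I"
  "monoid.mult (quotient_algebra A I) = rcoset_mult A I"
  "one (quotient_algebra A I) = I +>\<^bsub>A\<^esub> \<one>\<^bsub>A\<^esub>"
  "ring.zero (quotient_algebra A I) = I"
  "ring.add (quotient_algebra A I) = set_add A"
  by (simp_all add: quotient_algebra_def FactRing_def)

locale stable_ideal = assoc_algebra R A + ideal I A for R and A (structure) and I +
  assumes smult_mem: "\<lbrakk>r \<in> carrier R; x \<in> I\<rbrakk> \<Longrightarrow> r \<odot> x \<in> I"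
begin

abbreviation "Q \<equiv> quotient_algebra A I"
abbreviation "cls \<equiv> (+>\<^bsub>A\<^esub>) I"

lemma carrier_quotient: "carrier Q = cls ` carrier A"
  by (auto simp: quotient_algebra_simps A_RCOSETS_defs a_r_coset_def)

lemma cls_mult: "\<lbrakk>x \<in> carrier A; y \<in> carrier A\<rbrakk> \<Longrightarrow> cls x \<otimes>\<^bsub>Q\<^esub> cls y = cls (x \<otimes> y)"
  by (simp add: quotient_algebra_simps rcoset_mult_add)

lemma cls_add: "\<lbrakk>x \<in> carrier A; y \<in> carrier A\<rbrakk> \<Longrightarrow> cls x \<oplus>\<^bsub>Q\<^esub> cls y = cls (x \<oplus> y)"
  by (simp add: quotient_algebra_simps a_rcos_sum)

lemma cls_one: "\<one>\<^bsub>Q\<^esub> = cls \<one>"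
  by (simp add: quotient_algebra_simps)

lemma cls_zero: "\<zero>\<^bsub>Q\<^esub> = cls \<zero>"
  using a_subset by (simp add: quotient_algebra_simps)

lemma cls_eq_iff:
  assumes "x \<in> carrier A" "y \<in> carrier A"
  shows "cls x = cls y \<longleftrightarrow> x \<ominus> y \<in> I"
proof -
  have "x \<in> cls y \<longleftrightarrow> x \<ominus> y \<in> I"
    using a_rcos_module_minus[OF ring_axioms assms(2,1)] .
  then show ?thesis
    using a_rcos_self[OF assms(1)] a_repr_independence'[OF _ assms(2), of x] by auto
qed

text \<open>Stability of \<open>I\<close> under scalars makes all members of the union defining the scalar multiple equal.\<close>

lemma cls_smult:
  assumes r: "r \<in> carrier R" and x: "x \<in> carrier A"
  shows "r \<odot>\<^bsub>Q\<^esub> cls x = cls (r \<odot> x)"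
proof -
  have "cls (r \<odot> y) = cls (r \<odot> x)" if y: "y \<in> cls x" for y
  proof -
    obtain i where i: "i \<in> I" "y = i \<oplus> x"
      using y by (auto simp: a_r_coset_def r_coset_def)
    have "r \<odot> y = r \<odot> i \<oplus> r \<odot> x"
      using i r x by (simp add: smult_r_distr)
    then have "r \<odot> y \<in> cls (r \<odot> x)"
      using smult_mem[OF r i(1)] by (auto simp: a_r_coset_def r_coset_def)
    then show ?thesis
      using a_repr_independence' r x by simp
  qed
  moreover have "x \<in> cls x"
    using x by (rule a_rcos_self)
  ultimately have "(\<Union>y\<in>cls x. cls (r \<odot> y)) = cls (r \<odot> x)"
    by blast
  then show ?thesis
    by (simp add: quotient_algebra_def)
qed

lemma quotient_ring: "ring Q"
proof (rule ringI)
  show "abelian_group Q"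
  proof (rule abelian_groupI)
    show "\<exists>D\<in>carrier Q. D \<oplus>\<^bsub>Q\<^esub> C = \<zero>\<^bsub>Q\<^esub>" if C: "C \<in> carrier Q" for C
    proof -
      obtain x where x: "x \<in> carrier A" "C = cls x"
        using C by (auto simp: carrier_quotient)
      then have "cls (\<ominus> x) \<oplus>\<^bsub>Q\<^esub> C = \<zero>\<^bsub>Q\<^esub>"
        by (simp add: cls_add cls_zero l_neg)
      with x show ?thesis
        by (auto simp: carrier_quotient)
    qed
  qed (auto simp: carrier_quotient cls_add cls_zero a_ac)
  show "Group.monoid Q"
    by (rule monoidI) (auto simp: carrier_quotient cls_mult cls_one m_assoc)
next
  fix C D E assume "C \<in> carrier Q" "D \<in> carrier Q" "E \<in> carrier Q"
  then obtain x y z where "x \<in> carrier A" "y \<in> carrier A" "z \<in> carrier A"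
      "C = cls x" "D = cls y" "E = cls z"
    by (auto simp: carrier_quotient)
  then show "(C \<oplus>\<^bsub>Q\<^esub> D) \<otimes>\<^bsub>Q\<^esub> E = C \<otimes>\<^bsub>Q\<^esub> E \<oplus>\<^bsub>Q\<^esub> D \<otimes>\<^bsub>Q\<^esub> E"
    "E \<otimes>\<^bsub>Q\<^esub> (C \<oplus>\<^bsub>Q\<^esub> D) = E \<otimes>\<^bsub>Q\<^esub> C \<oplus>\<^bsub>Q\<^esub> E \<otimes>\<^bsub>Q\<^esub> D"
    by (simp_all add: cls_add cls_mult l_distr r_distr)
qed

lemma quotient_assoc_algebra: "assoc_algebra R Q"
proof -
  interpret quot: ring Q by (rule quotient_ring)
  have "module R Q"
    by (rule moduleI)
      (auto simp: carrier_quotient cls_smult cls_add smult_l_distr smult_r_distr smult_assoc1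
        R.is_cring quot.abelian_group_axioms)
  then show ?thesis
    by (intro assoc_algebra.intro assoc_algebra_axioms.intro quotient_ring)
      (auto simp: carrier_quotient cls_smult cls_mult smult_assoc_left smult_assoc_right)
qed

end

section \<open>Linear maps and free modules\<close>

lemma linear_maps_finsum:
  assumes "module R M" "module R N" and f: "f \<in> linear_maps R M N"
    and "finite S" "b \<in> S \<rightarrow> carrier M"
  shows "f (finsum M b S) = (\<Oplus>\<^bsub>N\<^esub>x\<in>S. f (b x))"
proof -
  interpret M: module R M by fact
  interpret N: module R N by fact
  have cl: "f m \<in> carrier N" if "m \<in> carrier M" for m
    using f that by (auto simp: linear_maps_def)
  have add: "f (m \<oplus>\<^bsub>M\<^esub> n) = f m \<oplus>\<^bsub>N\<^esub> f n" if "m \<in> carrier M" "n \<in> carrier M" for m n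
    using f that by (auto simp: linear_maps_def)
  have "f \<zero>\<^bsub>M\<^esub> = f \<zero>\<^bsub>M\<^esub> \<oplus>\<^bsub>N\<^esub> f \<zero>\<^bsub>M\<^esub>"
    using add[of "\<zero>\<^bsub>M\<^esub>" "\<zero>\<^bsub>M\<^esub>"] by simp
  then have z: "f \<zero>\<^bsub>M\<^esub> = \<zero>\<^bsub>N\<^esub>"
    using cl[of "\<zero>\<^bsub>M\<^esub>"] N.M.add.l_cancel_one'[of "f \<zero>\<^bsub>M\<^esub>" "f \<zero>\<^bsub>M\<^esub>"] by simp
  show ?thesis
    using assms(4,5)
  proof (induction S)
    case empty
    show ?case by (simp add: z)
  next
    case (insert x S)
    then have b: "b \<in> S \<rightarrow> carrier M" "b x \<in> carrier M" by auto
    then have fb: "(\<lambda>x. f (b x)) \<in> S \<rightarrow> carrier N" using cl by auto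
    show ?case
      using insert.hyps insert.IH[OF b(1)] b fb cl[OF b(2)]
      by (simp add: add[OF b(2) M.M.finsum_closed[OF b(1)]])
  qed
qed

lemma free_module_is_module:
  assumes "cring R"
  shows "module R (free_module R S)"
proof -
  interpret R: cring R by fact
  let ?F = "free_module R S"
  have sub: "finite {i \<in> S. h i \<noteq> \<zero>\<^bsub>R\<^esub>}"
    if "\<And>i. i \<in> S \<Longrightarrow> f i = \<zero>\<^bsub>R\<^esub> \<Longrightarrow> g i = \<zero>\<^bsub>R\<^esub> \<Longrightarrow> h i = \<zero>\<^bsub>R\<^esub>"
      "finite {i \<in> S. f i \<noteq> \<zero>\<^bsub>R\<^esub>}" "finite {i \<in> S. g i \<noteq> \<zero>\<^bsub>R\<^esub>}" for f g h
    by (rule finite_subset[OF _ finite_UnI[OF that(2,3)]]) (use that(1) in auto)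
  have add: "f \<oplus>\<^bsub>?F\<^esub> g \<in> carrier ?F" if "f \<in> carrier ?F" "g \<in> carrier ?F" for f g
    using that sub[of f g "\<lambda>i\<in>S. f i \<oplus>\<^bsub>R\<^esub> g i"] by (auto simp: free_module_def PiE_iff)
  have smult: "r \<odot>\<^bsub>?F\<^esub> f \<in> carrier ?F" if "r \<in> carrier R" "f \<in> carrier ?F" for r f
    using that sub[of f f "\<lambda>i\<in>S. r \<otimes>\<^bsub>R\<^esub> f i"] by (auto simp: free_module_def PiE_iff)
  have neg: "(\<lambda>i\<in>S. \<ominus>\<^bsub>R\<^esub> f i) \<in> carrier ?F" if "f \<in> carrier ?F" for f
    using that sub[of f f "\<lambda>i\<in>S. \<ominus>\<^bsub>R\<^esub> f i"] by (auto simp: free_module_def PiE_iff)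
  show ?thesis
  proof (rule moduleI)
    show "abelian_group ?F"
    proof (rule abelian_groupI)
      fix f assume f: "f \<in> carrier ?F"
      have "(\<lambda>i\<in>S. \<ominus>\<^bsub>R\<^esub> f i) \<oplus>\<^bsub>?F\<^esub> f = \<zero>\<^bsub>?F\<^esub>"
        using f by (auto simp: free_module_def fun_eq_iff PiE_iff R.l_neg)
      then show "\<exists>g\<in>carrier ?F. g \<oplus>\<^bsub>?F\<^esub> f = \<zero>\<^bsub>?F\<^esub>"
        using neg[OF f] by blast
    qed (use add in \<open>simp\<close>, auto simp: free_module_def fun_eq_iff PiE_iff extensional_def R.a_ac)
  qed (use smult assms in \<open>auto simp: free_module_def fun_eq_iff PiE_iff extensional_def
      R.l_distr R.r_distr R.m_assoc\<close>)
qed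

text \<open>A free module is a direct summand of itself, with complement \<open>0\<close>.\<close>

lemma projective_if_free:
  fixes S :: "'m set" and M :: "('r, 'm, 'd) module_scheme"
  assumes "cring R" "module_isomorphic R M (free_module R S)"
  shows "projective_module R M"
proof -
  interpret F: module R "free_module R S"
    using assms(1) by (rule free_module_is_module)
  let ?F = "free_module R S"
  have "submodule {\<zero>\<^bsub>?F\<^esub>} R ?F"
    by (rule F.submoduleI) auto
  moreover have "carrier ?F <+>\<^bsub>?F\<^esub> {\<zero>\<^bsub>?F\<^esub>} = carrier ?F"
    by (auto simp: set_add_def set_mult_def)
  moreover have "?F\<lparr>carrier := carrier ?F\<rparr> = ?F"
    by (simp add: free_module_def)
  ultimately show ?thesis
    unfolding projective_module_def Let_def
    using F.carrier_is_submodule F.M.zero_closed assms(2)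
    by (intro exI[of _ S] exI[of _ "carrier ?F"] exI[of _ "{\<zero>\<^bsub>?F\<^esub>}"]) simp
qed

lemma regular_module_int:
  "module \<Z> (regular_module \<Z>)" "finsum (regular_module \<Z>) f S = sum f S"
proof -
  show mod: "module \<Z> (regular_module \<Z>)"
    by (rule moduleI)
      (auto simp: regular_module_def int_is_cring algebra_simps intro!: abelian_groupI exI[of _ "- _"])
  interpret module \<Z> "regular_module \<Z>" by (rule mod)
  show "finsum (regular_module \<Z>) f S = sum f S"
  proof (induction S rule: infinite_finite_induct)
    case (insert x S)
    have "finsum (regular_module \<Z>) f (insert x S) = f x \<oplus>\<^bsub>regular_module \<Z>\<^esub> finsum (regular_module \<Z>) f S"
      by (rule M.finsum_insert[OF insert.hyps]) (simp_all add: regular_module_def)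
    then show ?case
      using insert by (simp add: regular_module_def)
  next
    case (infinite S)
    then show ?case
      using M.finsum_infinite[of S f] by (simp add: regular_module_def)
  next
    case empty
    then show ?case
      using M.finsum_empty[of f] by (simp add: regular_module_def)
  qed
qed

section \<open>The integral group ring\<close>

locale finite_group = group +
  assumes fin: "finite (carrier G)"
begin

abbreviation "ZG \<equiv> group_algebra \<Z> G"
abbreviation "\<delta> \<equiv> group_basis \<Z> G"

lemma carrier_ZG: "carrier ZG = (carrier G \<rightarrow>\<^sub>E UNIV)"
  using fin by (auto simp: group_algebra_def free_module_def)

lemma ZG_simps:
  "\<zero>\<^bsub>ZG\<^esub> = (\<lambda>x\<in>carrier G. 0)"
  "\<one>\<^bsub>ZG\<^esub> = \<delta> \<one>"
  "f \<oplus>\<^bsub>ZG\<^esub> h = (\<lambda>x\<in>carrier G. f x + h x)"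
  "r \<odot>\<^bsub>ZG\<^esub> f = (\<lambda>x\<in>carrier G. r * f x)"
  by (simp_all add: group_algebra_def free_module_def)

lemma \<delta>_apply: "x \<in> carrier G \<Longrightarrow> \<delta> g x = (if x = g then 1 else 0)"
  by (simp add: group_basis_def)

lemma \<delta>_closed [simp]: "\<delta> g \<in> carrier ZG"
  by (simp add: carrier_ZG group_basis_def)

lemma ZG_mult: "f \<otimes>\<^bsub>ZG\<^esub> h = (\<lambda>x\<in>carrier G. \<Sum>y\<in>carrier G. f y * h (inv y \<otimes> x))"
proof -
  have "(\<Sum>y\<in>{y \<in> carrier G. f y \<noteq> 0}. f y * h (inv y \<otimes> x))
      = (\<Sum>y\<in>carrier G. f y * h (inv y \<otimes> x))" for x
    by (rule sum.mono_neutral_left) (use fin in auto)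
  then show ?thesis
    by (simp add: group_algebra_def int_finsum_eq)
qed

lemma ZG_mult_closed [simp]: "f \<otimes>\<^bsub>ZG\<^esub> h \<in> carrier ZG"
  by (simp add: ZG_mult carrier_ZG)

lemma ZG_ext:
  "\<lbrakk>f \<in> carrier ZG; h \<in> carrier ZG; \<And>x. x \<in> carrier G \<Longrightarrow> f x = h x\<rbrakk> \<Longrightarrow> f = h"
  by (auto simp: carrier_ZG intro: PiE_ext)

lemma inv_cancel:
  "\<lbrakk>x \<in> carrier G; y \<in> carrier G\<rbrakk> \<Longrightarrow> x \<otimes> (inv x \<otimes> y) = y"
  "\<lbrakk>x \<in> carrier G; y \<in> carrier G\<rbrakk> \<Longrightarrow> inv x \<otimes> (x \<otimes> y) = y"
  by (simp_all add: m_assoc[symmetric])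

lemma sum_left_shift:
  assumes "u \<in> carrier G"
  shows "(\<Sum>y\<in>carrier G. k (u \<otimes> y)) = (\<Sum>y\<in>carrier G. k y)"
  by (rule sum.reindex_bij_witness[where i="\<lambda>y. inv u \<otimes> y" and j="\<lambda>y. u \<otimes> y"])
    (use assms in \<open>auto simp: m_assoc[symmetric]\<close>)

lemma sum_inverse: "(\<Sum>y\<in>carrier G. k (inv y)) = (\<Sum>y\<in>carrier G. k y)"
  by (rule sum.reindex_bij_witness[where i="m_inv G" and j="m_inv G"]) auto

lemma \<delta>_mult_apply:
  assumes "g \<in> carrier G" "x \<in> carrier G"
  shows "(\<delta> g \<otimes>\<^bsub>ZG\<^esub> f) x = f (inv g \<otimes> x)"
proof -
  have "(\<Sum>y\<in>carrier G. \<delta> g y * f (inv y \<otimes> x)) = (\<Sum>y\<in>carrier G. if y = g then f (inv y \<otimes> x) else 0)"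
    by (rule sum.cong) (auto simp: \<delta>_apply)
  then show ?thesis
    using assms fin by (simp add: ZG_mult)
qed

lemma ZG_mult_apply_right:
  assumes x: "x \<in> carrier G"
  shows "(f \<otimes>\<^bsub>ZG\<^esub> h) x = (\<Sum>y\<in>carrier G. f (x \<otimes> inv y) * h y)"
proof -
  have "(\<Sum>y\<in>carrier G. f y * h (inv y \<otimes> x)) = (\<Sum>y\<in>carrier G. f (x \<otimes> inv y) * h y)"
    by (rule sum.reindex_bij_witness[where i="\<lambda>y. x \<otimes> inv y" and j="\<lambda>y. inv y \<otimes> x"])
      (use x in \<open>auto simp: inv_mult_group m_assoc inv_cancel\<close>)
  then show ?thesis using x by (simp add: ZG_mult)
qed

lemma mult_\<delta>_apply:
  assumes "g \<in> carrier G" "x \<in> carrier G"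
  shows "(f \<otimes>\<^bsub>ZG\<^esub> \<delta> g) x = f (x \<otimes> inv g)"
proof -
  have "(\<Sum>y\<in>carrier G. f (x \<otimes> inv y) * \<delta> g y) = (\<Sum>y\<in>carrier G. if y = g then f (x \<otimes> inv y) else 0)"
    by (rule sum.cong) (auto simp: \<delta>_apply)
  then show ?thesis
    using assms fin by (simp add: ZG_mult_apply_right)
qed

lemma \<delta>_mult: "\<lbrakk>g \<in> carrier G; h \<in> carrier G\<rbrakk> \<Longrightarrow> \<delta> g \<otimes>\<^bsub>ZG\<^esub> \<delta> h = \<delta> (g \<otimes> h)"
proof (rule ZG_ext)
  fix x assume "g \<in> carrier G" "h \<in> carrier G" "x \<in> carrier G"
  then show "(\<delta> g \<otimes>\<^bsub>ZG\<^esub> \<delta> h) x = \<delta> (g \<otimes> h) x"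
    by (auto simp: \<delta>_mult_apply \<delta>_apply inv_cancel)
qed simp_all

text \<open>Both products expand to a sum over triples with product \<open>x\<close>; translating the inner variable by \<open>u\<close>
  identifies the two parametrisations.\<close>

lemma ZG_assoc:
  assumes "f \<in> carrier ZG" "h \<in> carrier ZG" "k \<in> carrier ZG"
  shows "(f \<otimes>\<^bsub>ZG\<^esub> h) \<otimes>\<^bsub>ZG\<^esub> k = f \<otimes>\<^bsub>ZG\<^esub> (h \<otimes>\<^bsub>ZG\<^esub> k)"
proof (rule ZG_ext)
  fix x assume x: "x \<in> carrier G"
  have "((f \<otimes>\<^bsub>ZG\<^esub> h) \<otimes>\<^bsub>ZG\<^esub> k) x
      = (\<Sum>y\<in>carrier G. \<Sum>u\<in>carrier G. f u * (h (inv u \<otimes> y) * k (inv y \<otimes> x)))"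
    using x by (auto simp: ZG_mult sum_distrib_right mult.assoc intro!: sum.cong)
  also have "\<dots> = (\<Sum>u\<in>carrier G. \<Sum>y\<in>carrier G. f u * (h (inv u \<otimes> y) * k (inv y \<otimes> x)))"
    by (rule sum.swap)
  also have "\<dots> = (\<Sum>u\<in>carrier G. \<Sum>v\<in>carrier G. f u * (h v * k (inv v \<otimes> (inv u \<otimes> x))))"
  proof (rule sum.cong)
    fix u assume u: "u \<in> carrier G"
    have "(\<Sum>y\<in>carrier G. f u * (h (inv u \<otimes> y) * k (inv y \<otimes> x)))
        = (\<Sum>v\<in>carrier G. f u * (h (inv u \<otimes> (u \<otimes> v)) * k (inv (u \<otimes> v) \<otimes> x)))"
      using sum_left_shift[OF u, of "\<lambda>y. f u * (h (inv u \<otimes> y) * k (inv y \<otimes> x))"] by simp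
    also have "\<dots> = (\<Sum>v\<in>carrier G. f u * (h v * k (inv v \<otimes> (inv u \<otimes> x))))"
      by (rule sum.cong) (use u x in \<open>auto simp: inv_mult_group m_assoc inv_cancel\<close>)
    finally show "(\<Sum>y\<in>carrier G. f u * (h (inv u \<otimes> y) * k (inv y \<otimes> x)))
        = (\<Sum>v\<in>carrier G. f u * (h v * k (inv v \<otimes> (inv u \<otimes> x))))" .
  qed simp
  also have "\<dots> = (f \<otimes>\<^bsub>ZG\<^esub> (h \<otimes>\<^bsub>ZG\<^esub> k)) x"
    using x by (auto simp: ZG_mult sum_distrib_left intro!: sum.cong)
  finally show "((f \<otimes>\<^bsub>ZG\<^esub> h) \<otimes>\<^bsub>ZG\<^esub> k) x = (f \<otimes>\<^bsub>ZG\<^esub> (h \<otimes>\<^bsub>ZG\<^esub> k)) x" .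
qed (auto simp: ZG_mult carrier_ZG)

lemma ZG_assoc_algebra: "assoc_algebra \<Z> ZG"
proof -
  have ab: "abelian_group ZG"
  proof (rule abelian_groupI)
    fix f assume "f \<in> carrier ZG"
    then show "\<exists>h\<in>carrier ZG. h \<oplus>\<^bsub>ZG\<^esub> f = \<zero>\<^bsub>ZG\<^esub>"
      by (intro bexI[of _ "\<lambda>x\<in>carrier G. - f x"])
        (auto simp: carrier_ZG ZG_simps cong: restrict_cong)
  qed (auto simp: carrier_ZG ZG_simps add_ac fun_eq_iff PiE_def extensional_def)
  have ring: "ring ZG"
  proof (rule ringI)
    show "Group.monoid ZG"
    proof (rule monoidI)
      show "\<one>\<^bsub>ZG\<^esub> \<otimes>\<^bsub>ZG\<^esub> f = f" "f \<otimes>\<^bsub>ZG\<^esub> \<one>\<^bsub>ZG\<^esub> = f" if f: "f \<in> carrier ZG" for f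
        by (rule ZG_ext; use f in \<open>simp add: ZG_simps \<delta>_mult_apply mult_\<delta>_apply\<close>;
            simp add: carrier_ZG ZG_mult)+
    qed (auto simp: ZG_assoc ZG_simps(2))
  next
    fix f h k assume "f \<in> carrier ZG" "h \<in> carrier ZG" "k \<in> carrier ZG"
    show "(f \<oplus>\<^bsub>ZG\<^esub> h) \<otimes>\<^bsub>ZG\<^esub> k = f \<otimes>\<^bsub>ZG\<^esub> k \<oplus>\<^bsub>ZG\<^esub> h \<otimes>\<^bsub>ZG\<^esub> k"
      by (auto simp: ZG_mult ZG_simps fun_eq_iff distrib_right sum.distrib)
    show "k \<otimes>\<^bsub>ZG\<^esub> (f \<oplus>\<^bsub>ZG\<^esub> h) = k \<otimes>\<^bsub>ZG\<^esub> f \<oplus>\<^bsub>ZG\<^esub> k \<otimes>\<^bsub>ZG\<^esub> h"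
      by (auto simp: ZG_mult ZG_simps fun_eq_iff distrib_left sum.distrib)
  qed (rule ab)
  have mod: "module \<Z> ZG"
    by (rule moduleI)
      (auto simp: int_is_cring ab carrier_ZG ZG_simps fun_eq_iff algebra_simps PiE_def extensional_def)
  show ?thesis
    by (intro assoc_algebra.intro assoc_algebra_axioms.intro mod ring)
      (auto simp: ZG_mult ZG_simps fun_eq_iff sum_distrib_left mult_ac)
qed

sublocale ZG: assoc_algebra \<Z> ZG
  by (rule ZG_assoc_algebra)

end

context finite_group
begin

definition aug :: "('a \<Rightarrow> int) \<Rightarrow> int" where
  "aug f = (\<Sum>x\<in>carrier G. f x)"

lemma aug_\<delta>: "g \<in> carrier G \<Longrightarrow> aug (\<delta> g) = 1"
  using fin by (simp add: aug_def \<delta>_apply cong: sum.cong)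

lemma aug_mult: "aug (f \<otimes>\<^bsub>ZG\<^esub> h) = aug f * aug h"
proof -
  have "aug (f \<otimes>\<^bsub>ZG\<^esub> h) = (\<Sum>y\<in>carrier G. \<Sum>x\<in>carrier G. f y * h (inv y \<otimes> x))"
    unfolding aug_def ZG_mult by (subst sum.swap) (simp cong: sum.cong)
  also have "\<dots> = (\<Sum>y\<in>carrier G. f y * aug h)"
    using sum_left_shift[of "inv _" h] by (simp add: sum_distrib_left[symmetric] aug_def)
  finally show ?thesis
    by (simp add: sum_distrib_right aug_def)
qed

lemma ZG_minus_apply:
  assumes "f \<in> carrier ZG" "h \<in> carrier ZG" "x \<in> carrier G"
  shows "(f \<ominus>\<^bsub>ZG\<^esub> h) x = f x - h x"
proof -
  have "\<ominus>\<^bsub>ZG\<^esub> h = (\<lambda>x\<in>carrier G. - h x)"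
    by (rule ZG.minus_equality) (use assms in \<open>auto simp: carrier_ZG ZG_simps cong: restrict_cong\<close>)
  then show ?thesis
    using assms by (simp add: ZG.minus_eq ZG_simps)
qed

lemma aug_minus: "f \<in> carrier ZG \<Longrightarrow> h \<in> carrier ZG \<Longrightarrow> aug (f \<ominus>\<^bsub>ZG\<^esub> h) = aug f - aug h"
  by (simp add: aug_def ZG_minus_apply sum_subtractf cong: sum.cong)

end

section \<open>Central generators of the augmentation ideal\<close>

text \<open>The central parts \<open>s\<close>, \<open>t\<close> of \<open>u = s + u'z\<close>, \<open>v = t + v'z\<close> cancel in the commutator, which leaves
  \<open>(u'v' - v'u')z\<^sup>2\<close>; the induction hypothesis applies to \<open>u'\<close>, \<open>v'\<close>. One of the two factors \<open>z\<close> gained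
  in each step would suffice, so the other is absorbed into the coefficient.\<close>

lemma (in ring) commutator_in_central_powers:
  assumes z: "z \<in> carrier R" and z_central: "\<And>a. a \<in> carrier R \<Longrightarrow> z \<otimes> a = a \<otimes> z"
    and decomp: "\<And>a. a \<in> carrier R \<Longrightarrow>
      \<exists>s\<in>carrier R. \<exists>b\<in>carrier R. (\<forall>c\<in>carrier R. s \<otimes> c = c \<otimes> s) \<and> a = s \<oplus> b \<otimes> z"
    and "u \<in> carrier R" "v \<in> carrier R"
  shows "\<exists>c\<in>carrier R. u \<otimes> v \<ominus> v \<otimes> u = c \<otimes> z [^] (n::nat)"
  using assms(4,5)
proof (induction n arbitrary: u v)
  case 0
  then show ?case by (intro bexI[of _ "u \<otimes> v \<ominus> v \<otimes> u"]) simp_all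
next
  case (Suc n)
  obtain s u' where s: "s \<in> carrier R" "\<And>c. c \<in> carrier R \<Longrightarrow> s \<otimes> c = c \<otimes> s"
    and u': "u' \<in> carrier R" "u = s \<oplus> u' \<otimes> z"
    using decomp[OF Suc.prems(1)] by blast
  obtain t v' where t: "t \<in> carrier R" "\<And>c. c \<in> carrier R \<Longrightarrow> t \<otimes> c = c \<otimes> t"
    and v': "v' \<in> carrier R" "v = t \<oplus> v' \<otimes> z"
    using decomp[OF Suc.prems(2)] by blast
  obtain c where c: "c \<in> carrier R" "u' \<otimes> v' \<ominus> v' \<otimes> u' = c \<otimes> z [^] n"
    using Suc.IH[OF u'(1) v'(1)] by blast
  define K where "K = s \<otimes> t \<oplus> s \<otimes> (v' \<otimes> z) \<oplus> t \<otimes> (u' \<otimes> z)"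
  have K: "K \<in> carrier R"
    using s(1) t(1) u'(1) v'(1) z by (simp add: K_def)
  have swap: "a \<otimes> z \<otimes> (b \<otimes> z) = a \<otimes> b \<otimes> (z \<otimes> z)" if "a \<in> carrier R" "b \<in> carrier R" for a b
  proof -
    have "a \<otimes> z \<otimes> (b \<otimes> z) = a \<otimes> (z \<otimes> b) \<otimes> z"
      using that z by (simp add: m_assoc)
    then show ?thesis
      using that z by (simp add: z_central[of b] m_assoc)
  qed
  have "t \<otimes> (u' \<otimes> z) = u' \<otimes> z \<otimes> t" "s \<otimes> (v' \<otimes> z) = v' \<otimes> z \<otimes> s" "t \<otimes> s = s \<otimes> t"
    using s(2)[of "v' \<otimes> z"] t(2)[of "u' \<otimes> z"] s(2)[of t] s(1) t(1) u'(1) v'(1) z by simp_all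
  note comm = this
  have "u \<otimes> v = s \<otimes> t \<oplus> s \<otimes> (v' \<otimes> z) \<oplus> (u' \<otimes> z \<otimes> t \<oplus> u' \<otimes> z \<otimes> (v' \<otimes> z))"
    unfolding u'(2) v'(2) using s(1) t(1) u'(1) v'(1) z by (simp add: l_distr r_distr a_ac)
  then have uv: "u \<otimes> v = K \<oplus> u' \<otimes> v' \<otimes> (z \<otimes> z)"
    unfolding K_def comm(1) swap[OF u'(1) v'(1)] using s(1) t(1) u'(1) v'(1) z by (simp add: a_ac)
  have "v \<otimes> u = t \<otimes> s \<oplus> t \<otimes> (u' \<otimes> z) \<oplus> (v' \<otimes> z \<otimes> s \<oplus> v' \<otimes> z \<otimes> (u' \<otimes> z))"
    unfolding u'(2) v'(2) using s(1) t(1) u'(1) v'(1) z by (simp add: l_distr r_distr a_ac)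
  then have vu: "v \<otimes> u = K \<oplus> v' \<otimes> u' \<otimes> (z \<otimes> z)"
    unfolding K_def comm(2,3) swap[OF v'(1) u'(1)] using s(1) t(1) u'(1) v'(1) z by (simp add: a_ac)
  have "(K \<oplus> a) \<ominus> (K \<oplus> b) = a \<ominus> b" if "a \<in> carrier R" "b \<in> carrier R" for a b
    using that K by (simp add: minus_eq minus_add a_assoc a_lcomm[of a "\<ominus> K"] r_neg2)
  then have "u \<otimes> v \<ominus> v \<otimes> u = (u' \<otimes> v' \<ominus> v' \<otimes> u') \<otimes> (z \<otimes> z)"
    unfolding uv vu using u'(1) v'(1) z by (simp add: minus_eq l_distr l_minus)
  also have "\<dots> = (c \<otimes> z) \<otimes> z [^] Suc n"
  proof -
    have "z [^] n \<otimes> (z \<otimes> z) = z \<otimes> z [^] Suc n"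
      using z z_central[of "z [^] n"] by (simp add: m_assoc[symmetric])
    then show ?thesis
      using c z by (simp add: m_assoc)
  qed
  finally show ?case
    using c z by blast
qed

text \<open>On each right coset of \<open>H\<close> the function is constant modulo \<open>|H|\<close>, so its sum over the coset is
  \<open>|H|\<close> times a value of \<open>w\<close>, up to multiples of \<open>|H|\<close>.\<close>

lemma (in group) card_subgroup_dvd_sum:
  fixes w :: "'a \<Rightarrow> int"
  assumes fin: "finite (carrier G)" and H: "subgroup H G"
    and inv: "\<And>h t. \<lbrakk>h \<in> H; t \<in> carrier G\<rbrakk> \<Longrightarrow> int (card H) dvd w (h \<otimes> t) - w t"
  shows "int (card H) dvd (\<Sum>x\<in>carrier G. w x)"
proof -
  have "int (card H) dvd sum w C" if C: "C \<in> rcosets H" for C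
  proof -
    obtain t where t: "t \<in> carrier G" "C = H #> t"
      using C by (auto simp: RCOSETS_def)
    have "inj_on (\<lambda>h. h \<otimes> t) H"
      using t(1) subgroup.subset[OF H] by (auto intro!: inj_onI simp: subset_iff)
    moreover have "C = (\<lambda>h. h \<otimes> t) ` H"
      using t by (auto simp: r_coset_def)
    ultimately have "sum w C = (\<Sum>h\<in>H. w (h \<otimes> t))"
      by (simp add: sum.reindex)
    also have "\<dots> = (\<Sum>h\<in>H. w (h \<otimes> t) - w t) + int (card H) * w t"
      by (simp add: sum_subtractf)
    also have "int (card H) dvd \<dots>"
      using t(1) by (intro dvd_add dvd_sum inv) auto
    finally show ?thesis .
  qed
  moreover have "(\<Sum>x\<in>carrier G. w x) = (\<Sum>C\<in>rcosets H. sum w C)"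
    using sum.Union_disjoint[of "rcosets H" w] rcosets_part_G[OF H] rcos_disjoint[OF H]
      finite_subset[OF _ fin] subgroup.rcosets_carrier[OF H is_group]
    by (auto simp: pairwise_def disjnt_def)
  ultimately show ?thesis
    by (auto intro: dvd_sum)
qed

lemma (in comm_group) finprod_int_pow:
  "g \<in> S \<rightarrow> carrier G \<Longrightarrow> (\<Otimes>x\<in>S. g x [^] (c::int)) = (\<Otimes>x\<in>S. g x) [^] c"
proof (induction S rule: infinite_finite_induct)
  case (insert x S)
  then have "g x \<in> carrier G" "g \<in> S \<rightarrow> carrier G" by auto
  with insert show ?case
    by (simp add: int_pow_distrib Pi_iff)
qed simp_all

lemma (in comm_group) finprod_pow_sum:
  "finite S \<Longrightarrow> y \<in> carrier G \<Longrightarrow> (\<Otimes>x\<in>S. y [^] (k x :: int)) = y [^] (\<Sum>x\<in>S. k x)"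
  by (induction S rule: finite_induct) (simp_all add: int_pow_mult Pi_iff)

text \<open>The augmentation ideal is principal with a central generator. These assumptions are exactly what a
  bimodule isomorphism between the quotient algebra and its dual provides.\<close>

locale central_augmentation_generator = finite_group +
  fixes z
  assumes z_closed: "z \<in> carrier (group_algebra \<Z> G)"
    and z_central: "f \<in> carrier (group_algebra \<Z> G) \<Longrightarrow>
      z \<otimes>\<^bsub>group_algebra \<Z> G\<^esub> f = f \<otimes>\<^bsub>group_algebra \<Z> G\<^esub> z"
    and aug_z: "aug z = 0"
    and generates: "\<lbrakk>u \<in> carrier (group_algebra \<Z> G); aug u = 0\<rbrakk> \<Longrightarrow>
      \<exists>a\<in>carrier (group_algebra \<Z> G). u = a \<otimes>\<^bsub>group_algebra \<Z> G\<^esub> z"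
begin

text \<open>An element minus its augmentation has augmentation zero, hence is a multiple of \<open>z\<close>; so the
  hypotheses of \<open>commutator_in_central_powers\<close> are met.\<close>

lemma commutes_modulo_z_power:
  assumes "u \<in> carrier ZG" "v \<in> carrier ZG"
  shows "\<exists>c\<in>carrier ZG. u \<otimes>\<^bsub>ZG\<^esub> v \<ominus>\<^bsub>ZG\<^esub> v \<otimes>\<^bsub>ZG\<^esub> u = c \<otimes>\<^bsub>ZG\<^esub> z [^]\<^bsub>ZG\<^esub> (n::nat)"
proof (rule ZG.commutator_in_central_powers[OF z_closed z_central])
  fix a assume a: "a \<in> carrier ZG"
  define s where "s = aug a \<odot>\<^bsub>ZG\<^esub> \<one>\<^bsub>ZG\<^esub>"
  have s: "s \<in> carrier ZG" by (simp add: s_def)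
  have "aug s = aug a"
    using aug_\<delta>[of \<one>] by (simp add: s_def aug_def ZG_simps sum_distrib_left[symmetric] cong: sum.cong)
  then obtain b where b: "b \<in> carrier ZG" "a \<ominus>\<^bsub>ZG\<^esub> s = b \<otimes>\<^bsub>ZG\<^esub> z"
    using generates[of "a \<ominus>\<^bsub>ZG\<^esub> s"] a s by (auto simp: aug_minus)
  have "a = s \<oplus>\<^bsub>ZG\<^esub> (a \<ominus>\<^bsub>ZG\<^esub> s)"
    using a s by (simp add: ZG.minus_eq ZG.M.a_lcomm ZG.M.r_neg)
  moreover have "s \<otimes>\<^bsub>ZG\<^esub> c = c \<otimes>\<^bsub>ZG\<^esub> s" if "c \<in> carrier ZG" for c
    using that by (simp add: s_def ZG.smult_assoc_left ZG.smult_assoc_right)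
  ultimately show "\<exists>s\<in>carrier ZG. \<exists>b\<in>carrier ZG.
      (\<forall>c\<in>carrier ZG. s \<otimes>\<^bsub>ZG\<^esub> c = c \<otimes>\<^bsub>ZG\<^esub> s) \<and> a = s \<oplus>\<^bsub>ZG\<^esub> b \<otimes>\<^bsub>ZG\<^esub> z"
    using s b by metis
qed (use assms in auto)

text \<open>The reductions of the powers of \<open>z\<close> modulo \<open>N\<close> take finitely many values, so two of them agree.\<close>

lemma z_powers_periodic:
  assumes "N > 0"
  obtains n k :: nat where "k > 0"
    "\<And>x. x \<in> carrier G \<Longrightarrow> N dvd (z [^]\<^bsub>ZG\<^esub> n) x - (z [^]\<^bsub>ZG\<^esub> (n + k)) x"
proof -
  define F where "F n = (\<lambda>x\<in>carrier G. (z [^]\<^bsub>ZG\<^esub> n) x mod N)" for n :: nat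
  have "range F \<subseteq> carrier G \<rightarrow>\<^sub>E {0..<N}"
    using assms by (auto simp: F_def)
  then have "finite (range F)"
    by (rule finite_subset) (intro finite_PiE fin, simp)
  then have "\<not> inj F"
    using finite_imageD by blast
  then obtain n m where nm: "n < m" "F n = F m"
    unfolding inj_on_def by (metis linorder_neqE_nat)
  have "N dvd (z [^]\<^bsub>ZG\<^esub> n) x - (z [^]\<^bsub>ZG\<^esub> (n + (m - n))) x" if "x \<in> carrier G" for x
    using fun_cong[OF nm(2), of x] nm(1) that by (simp add: F_def mod_eq_dvd_iff)
  then show thesis
    using that[of "m - n" n] nm(1) by simp
qed

text \<open>The element \<open>w = 1 - z\<^sup>k\<close> annihilates \<open>z\<^sup>n\<close>, and hence every commutator, modulo the group order,
  while its augmentation is \<open>1\<close>. Invariance of \<open>w\<close> under a nontrivial translation modulo the group order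
  would force its augmentation to be divisible by an integer greater than \<open>1\<close>.\<close>

lemma commutative:
  assumes x: "x \<in> carrier G" and y: "y \<in> carrier G"
  shows "x \<otimes> y = y \<otimes> x"
proof -
  define N where "N = int (card (carrier G))"
  have "N > 0" using fin by (auto simp: N_def card_gt_0_iff)
  then obtain k n :: nat where k: "k > 0"
    and per: "\<And>t. t \<in> carrier G \<Longrightarrow> N dvd (z [^]\<^bsub>ZG\<^esub> n) t - (z [^]\<^bsub>ZG\<^esub> (n + k)) t"
    using z_powers_periodic by metis
  define w where "w = \<one>\<^bsub>ZG\<^esub> \<ominus>\<^bsub>ZG\<^esub> z [^]\<^bsub>ZG\<^esub> k"
  have zp: "z [^]\<^bsub>ZG\<^esub> m \<in> carrier ZG" for m :: nat
    using z_closed by simp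
  have w: "w \<in> carrier ZG"
    using zp by (simp add: w_def)
  have "aug (z [^]\<^bsub>ZG\<^esub> k) = 0"
    using k aug_z by (cases k) (simp_all add: aug_mult)
  then have aug_w: "aug w = 1"
    using zp aug_\<delta>[of \<one>] by (simp add: w_def aug_minus ZG_simps(2))
  have zw: "z [^]\<^bsub>ZG\<^esub> n \<otimes>\<^bsub>ZG\<^esub> w = z [^]\<^bsub>ZG\<^esub> n \<ominus>\<^bsub>ZG\<^esub> z [^]\<^bsub>ZG\<^esub> (n + k)"
    using zp z_closed by (simp add: w_def ZG.minus_eq ZG.r_distr ZG.r_minus ZG.nat_pow_mult)
  obtain c where c: "c \<in> carrier ZG"
    "\<delta> (x \<otimes> y) \<ominus>\<^bsub>ZG\<^esub> \<delta> (y \<otimes> x) = c \<otimes>\<^bsub>ZG\<^esub> z [^]\<^bsub>ZG\<^esub> n"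
    using commutes_modulo_z_power[of "\<delta> x" "\<delta> y" n] x y by (auto simp: \<delta>_mult)
  have "(\<delta> (x \<otimes> y) \<ominus>\<^bsub>ZG\<^esub> \<delta> (y \<otimes> x)) \<otimes>\<^bsub>ZG\<^esub> w = c \<otimes>\<^bsub>ZG\<^esub> (z [^]\<^bsub>ZG\<^esub> n \<otimes>\<^bsub>ZG\<^esub> w)"
    using c w zp by (simp add: ZG_assoc)
  moreover have "(\<delta> (x \<otimes> y) \<ominus>\<^bsub>ZG\<^esub> \<delta> (y \<otimes> x)) \<otimes>\<^bsub>ZG\<^esub> w
      = \<delta> (x \<otimes> y) \<otimes>\<^bsub>ZG\<^esub> w \<ominus>\<^bsub>ZG\<^esub> \<delta> (y \<otimes> x) \<otimes>\<^bsub>ZG\<^esub> w"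
    using w by (simp add: ZG.minus_eq ZG.l_distr ZG.l_minus)
  ultimately have eq: "\<delta> (x \<otimes> y) \<otimes>\<^bsub>ZG\<^esub> w \<ominus>\<^bsub>ZG\<^esub> \<delta> (y \<otimes> x) \<otimes>\<^bsub>ZG\<^esub> w
      = c \<otimes>\<^bsub>ZG\<^esub> (z [^]\<^bsub>ZG\<^esub> n \<ominus>\<^bsub>ZG\<^esub> z [^]\<^bsub>ZG\<^esub> (n + k))"
    by (simp add: zw)
  \<comment> \<open>Modulo \<open>N\<close> the product of \<open>xy - yx\<close> with \<open>w\<close> vanishes; its coefficient at \<open>t\<close> is this difference.\<close>
  have cong: "N dvd w (inv (x \<otimes> y) \<otimes> t) - w (inv (y \<otimes> x) \<otimes> t)" if t: "t \<in> carrier G" for t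
  proof -
    have "w (inv (x \<otimes> y) \<otimes> t) - w (inv (y \<otimes> x) \<otimes> t)
        = (c \<otimes>\<^bsub>ZG\<^esub> (z [^]\<^bsub>ZG\<^esub> n \<ominus>\<^bsub>ZG\<^esub> z [^]\<^bsub>ZG\<^esub> (n + k))) t"
      using t x y w by (simp flip: eq add: ZG_minus_apply \<delta>_mult_apply)
    also have "N dvd \<dots>"
      using t per zp by (auto simp: ZG_mult ZG_minus_apply intro!: dvd_sum dvd_mult)
    finally show ?thesis .
  qed
  \<comment> \<open>The translations that preserve \<open>w\<close> modulo \<open>N\<close>. Their number divides \<open>N\<close>, so congruence modulo \<open>N\<close>
    implies congruence modulo \<open>|H|\<close>.\<close>
  define H where "H = {h \<in> carrier G. \<forall>t\<in>carrier G. N dvd w (h \<otimes> t) - w t}"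
  have H: "subgroup H G"
  proof (rule subgroupI)
    fix h assume h: "h \<in> H"
    have "N dvd w (inv h \<otimes> t) - w t" if "t \<in> carrier G" for t
    proof -
      have "N dvd w (h \<otimes> (inv h \<otimes> t)) - w (inv h \<otimes> t)"
        using h that unfolding H_def by blast
      then show ?thesis
        using h that by (simp add: H_def inv_cancel dvd_diff_commute)
    qed
    then show "inv h \<in> H"
      using h by (simp add: H_def)
  next
    fix g h assume gh: "g \<in> H" "h \<in> H"
    have "N dvd w (g \<otimes> h \<otimes> t) - w t" if "t \<in> carrier G" for t
    proof -
      have "N dvd (w (g \<otimes> (h \<otimes> t)) - w (h \<otimes> t)) + (w (h \<otimes> t) - w t)"
        using gh that by (intro dvd_add) (auto simp: H_def)
      then show ?thesis
        using gh that by (simp add: H_def m_assoc)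
    qed
    then show "g \<otimes> h \<in> H"
      using gh by (simp add: H_def)
  next
    have "\<one> \<in> H" by (simp add: H_def)
    then show "H \<noteq> {}" by blast
  qed (auto simp: H_def)
  have "card H dvd card (carrier G)"
    using lagrange[OF H] by (metis dvd_triv_right order_def)
  then have HN: "int (card H) dvd N"
    by (simp add: N_def)
  have "int (card H) dvd aug w"
    unfolding aug_def
    by (rule card_subgroup_dvd_sum[OF fin H]) (use HN in \<open>auto simp: H_def intro: dvd_trans\<close>)
  then have "card H = 1"
    by (simp add: aug_w)
  moreover have "\<one> \<in> H"
    by (rule subgroup.one_closed[OF H])
  moreover have "inv (x \<otimes> y) \<otimes> (y \<otimes> x) \<in> H"
    unfolding H_def
  proof (intro CollectI conjI ballI)
    fix t assume t: "t \<in> carrier G"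
    have "N dvd w (inv (x \<otimes> y) \<otimes> (y \<otimes> x \<otimes> t)) - w (inv (y \<otimes> x) \<otimes> (y \<otimes> x \<otimes> t))"
      using cong x y t by simp
    then show "N dvd w (inv (x \<otimes> y) \<otimes> (y \<otimes> x) \<otimes> t) - w t"
      using x y t inv_cancel(2)[of "y \<otimes> x" t] by (simp add: m_assoc)
  qed (use x y in simp)
  ultimately have "inv (x \<otimes> y) \<otimes> (y \<otimes> x) = \<one>"
    by (metis card_1_singletonE singletonD)
  then show ?thesis
    using x y by (metis inv_equality inv_inv m_closed inv_closed inv_comm l_inv r_cancel inv_cancel(1) r_one)
qed

text \<open>The map \<open>\<phi>\<close> is the identification of the augmentation ideal modulo its square with the abelian group
  \<open>G\<close>, extended to the whole group ring. Translating \<open>z\<close> by \<open>y\<close> multiplies \<open>\<phi>(z)\<close> by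
  a power of \<open>y\<close> with exponent the augmentation of \<open>z\<close>, which is zero.\<close>

lemma cyclic: "cyclic_group G"
proof -
  interpret comm_group G
    by (rule group_comm_groupI) (rule commutative)
  define \<phi> where "\<phi> f = (\<Otimes>x\<in>carrier G. x [^] (f x :: int))" for f
  define \<zeta> where "\<zeta> = \<phi> z"
  have closed: "\<phi> f \<in> carrier G" for f
    by (simp add: \<phi>_def)
  have cong: "\<phi> f = \<phi> h" if "\<And>x. x \<in> carrier G \<Longrightarrow> f x = h x" for f h
    unfolding \<phi>_def by (rule finprod_cong') (auto simp: that)
  have add: "\<phi> (\<lambda>x. f x + h x) = \<phi> f \<otimes> \<phi> h" for f h
    by (simp add: \<phi>_def int_pow_mult Pi_iff finprod_multf cong: finprod_cong)
  have scale: "\<phi> (\<lambda>x. c * f x) = \<phi> f [^] c" for c f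
  proof -
    have "\<phi> (\<lambda>x. c * f x) = (\<Otimes>x\<in>carrier G. (x [^] f x) [^] c)"
      unfolding \<phi>_def by (rule finprod_cong') (auto simp: int_pow_pow mult.commute)
    then show ?thesis
      by (simp add: \<phi>_def finprod_int_pow)
  qed
  have shift: "\<phi> (\<lambda>x. z (inv y \<otimes> x)) = \<zeta>" if y: "y \<in> carrier G" for y
  proof -
    have "\<phi> (\<lambda>x. z (inv y \<otimes> x)) = (\<Otimes>x\<in>(\<lambda>t. y \<otimes> t) ` carrier G. x [^] z (inv y \<otimes> x))"
      using y by (simp add: \<phi>_def surj_const_mult)
    also have "\<dots> = (\<Otimes>t\<in>carrier G. (y \<otimes> t) [^] z (inv y \<otimes> (y \<otimes> t)))"
      using y by (subst finprod_reindex) (auto simp: inj_on_cmult)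
    also have "\<dots> = (\<Otimes>t\<in>carrier G. y [^] z t \<otimes> t [^] z t)"
      using y by (intro finprod_cong') (auto simp: inv_cancel int_pow_distrib)
    also have "\<dots> = y [^] aug z \<otimes> \<zeta>"
      using y fin by (simp add: finprod_multf Pi_iff finprod_pow_sum aug_def \<zeta>_def \<phi>_def)
    finally show ?thesis
      using closed by (simp add: aug_z \<zeta>_def)
  qed
  \<comment> \<open>For \<open>S = G\<close> the argument of \<open>\<phi>\<close> is the product \<open>az\<close>.\<close>
  have conv: "\<phi> (\<lambda>x. \<Sum>y\<in>S. a y * z (inv y \<otimes> x)) = \<zeta> [^] (\<Sum>y\<in>S. a y)"
    if "finite S" "S \<subseteq> carrier G" for S a
    using that
  proof (induction S rule: finite_induct)
    case empty
    then show ?case by (simp add: \<phi>_def)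
  next
    case (insert y S)
    then show ?case
      using closed by (simp add: add scale shift int_pow_mult \<zeta>_def)
  qed
  have "g \<in> range (\<lambda>n::int. \<zeta> [^] n)" if g: "g \<in> carrier G" for g
  proof -
    have "aug (\<delta> g \<ominus>\<^bsub>ZG\<^esub> \<delta> \<one>) = 0"
      using g by (simp add: aug_minus aug_\<delta>)
    then obtain a where a: "a \<in> carrier ZG" "\<delta> g \<ominus>\<^bsub>ZG\<^esub> \<delta> \<one> = a \<otimes>\<^bsub>ZG\<^esub> z"
      using generates[of "\<delta> g \<ominus>\<^bsub>ZG\<^esub> \<delta> \<one>"] by auto
    have basis: "\<phi> (\<delta> h) = h" if "h \<in> carrier G" for h
    proof -
      have "\<phi> (\<delta> h) = (\<Otimes>x\<in>carrier G. if x = h then x else \<one>)"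
        unfolding \<phi>_def by (rule finprod_cong') (auto simp: \<delta>_apply)
      then show ?thesis
        using that fin finprod_singleton_swap[of h "carrier G" "\<lambda>x. x"] by simp
    qed
    have "\<phi> (\<delta> g) = \<phi> (\<lambda>x. (a \<otimes>\<^bsub>ZG\<^esub> z) x + \<delta> \<one> x)"
      by (rule cong) (simp flip: a(2) add: ZG_minus_apply)
    then have "g = \<phi> (a \<otimes>\<^bsub>ZG\<^esub> z)"
      using g closed by (simp add: add basis)
    also have "\<dots> = \<zeta> [^] aug a"
      using conv[OF fin subset_refl, of a] cong[of "a \<otimes>\<^bsub>ZG\<^esub> z"] by (simp add: ZG_mult aug_def)
    finally show ?thesis by blast
  qed
  then have "carrier G = range (\<lambda>n::int. \<zeta> [^] n)"
    using closed[of z] unfolding \<zeta>_def by (auto simp: int_pow_closed)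
  then show ?thesis
    using closed[of z] unfolding cyclic_group \<zeta>_def by blast
qed

end

section \<open>Functionals on the quotient by the norm element\<close>

context finite_group
begin

abbreviation "norm_ideal \<equiv> scalar_multiples \<Z> ZG (group_sum \<Z> G)"
abbreviation "Q \<equiv> quotient_algebra ZG norm_ideal"
abbreviation "cls \<equiv> (+>\<^bsub>ZG\<^esub>) norm_ideal"

lemma ZG_finsum:
  "finite S \<Longrightarrow> F \<in> S \<rightarrow> carrier ZG \<Longrightarrow> finsum ZG F S = (\<lambda>x\<in>carrier G. \<Sum>i\<in>S. F i x)"
  by (induction S rule: finite_induct) (auto simp: ZG_simps fun_eq_iff)

lemma basis_combination:
  assumes "B \<subseteq> carrier G"
  shows "(\<Oplus>\<^bsub>ZG\<^esub>x\<in>B. a x \<odot>\<^bsub>ZG\<^esub> \<delta> x) = (\<lambda>t\<in>carrier G. if t \<in> B then a t else 0)"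
proof -
  have B: "finite B" using assms fin by (rule finite_subset)
  have "(\<Sum>x\<in>B. (a x \<odot>\<^bsub>ZG\<^esub> \<delta> x) t) = (if t \<in> B then a t else 0)" if "t \<in> carrier G" for t
  proof -
    have "(\<Sum>x\<in>B. (a x \<odot>\<^bsub>ZG\<^esub> \<delta> x) t) = (\<Sum>x\<in>B. if t = x then a x else 0)"
      using that by (intro sum.cong) (simp_all add: ZG_simps \<delta>_apply)
    then show ?thesis using B by simp
  qed
  then show ?thesis
    using B by (subst ZG_finsum) (auto simp: fun_eq_iff)
qed

lemma group_sum_eq: "group_sum \<Z> G = (\<lambda>x\<in>carrier G. 1)"
  unfolding group_sum_def using fin by (subst ZG_finsum) (auto simp: fun_eq_iff \<delta>_apply)

lemma mem_norm_ideal: "f \<in> norm_ideal \<longleftrightarrow> (\<exists>r. f = (\<lambda>x\<in>carrier G. r))"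
  by (auto simp: scalar_multiples_def group_sum_eq ZG_simps fun_eq_iff cong: restrict_cong)

lemma norm_idealI: "(\<And>x. x \<in> carrier G \<Longrightarrow> f x = r) \<Longrightarrow> f \<in> carrier ZG \<Longrightarrow> f \<in> norm_ideal"
  unfolding mem_norm_ideal by (rule exI[of _ r]) (rule ZG_ext, auto simp: carrier_ZG)

lemma norm_ideal_subset: "norm_ideal \<subseteq> carrier ZG"
  by (auto simp: mem_norm_ideal carrier_ZG)

lemma norm_ideal_is_ideal: "ideal norm_ideal ZG"
proof (rule idealI[OF ZG.ring_axioms])
  show "subgroup norm_ideal (add_monoid ZG)"
  proof (rule ZG.add.subgroupI)
    show "norm_ideal \<noteq> {}" using mem_norm_ideal by blast
  next
    fix f assume f: "f \<in> norm_ideal"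
    then obtain r where r: "f = (\<lambda>x\<in>carrier G. r)" by (auto simp: mem_norm_ideal)
    have "\<ominus>\<^bsub>ZG\<^esub> f = (\<lambda>x\<in>carrier G. - r)"
      by (rule ZG.minus_equality) (auto simp: r carrier_ZG ZG_simps cong: restrict_cong)
    then show "\<ominus>\<^bsub>ZG\<^esub> f \<in> norm_ideal" by (auto simp: mem_norm_ideal)
  next
    fix f g assume "f \<in> norm_ideal" "g \<in> norm_ideal"
    then obtain r s where "f = (\<lambda>x\<in>carrier G. r)" "g = (\<lambda>x\<in>carrier G. s)"
      by (auto simp: mem_norm_ideal)
    then show "f \<oplus>\<^bsub>ZG\<^esub> g \<in> norm_ideal"
      by (auto simp: mem_norm_ideal ZG_simps fun_eq_iff intro!: exI[of _ "r + s"])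
  qed (rule norm_ideal_subset)
next
  fix f h assume f: "f \<in> norm_ideal" and h: "h \<in> carrier ZG"
  obtain r where r: "f = (\<lambda>x\<in>carrier G. r)" using f by (auto simp: mem_norm_ideal)
  show "h \<otimes>\<^bsub>ZG\<^esub> f \<in> norm_ideal"
    by (rule norm_idealI[of _ "aug h * r"], unfold r)
      (simp_all add: ZG_mult[of h] aug_def sum_distrib_right carrier_ZG cong: sum.cong)
  show "f \<otimes>\<^bsub>ZG\<^esub> h \<in> norm_ideal"
    by (rule norm_idealI[of _ "r * aug h"]) (simp_all add: r ZG_mult_apply_right aug_def sum_distrib_left)
qed

sublocale quot: stable_ideal \<Z> ZG norm_ideal
proof (intro stable_ideal.intro ZG_assoc_algebra norm_ideal_is_ideal stable_ideal_axioms.intro)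
  fix r :: int and f assume "f \<in> norm_ideal"
  then obtain s where "f = (\<lambda>x\<in>carrier G. s)" by (auto simp: mem_norm_ideal)
  then show "r \<odot>\<^bsub>ZG\<^esub> f \<in> norm_ideal"
    by (auto simp: mem_norm_ideal ZG_simps fun_eq_iff intro!: exI[of _ "r * s"])
qed

lemma cls_eq_iff:
  assumes "f \<in> carrier ZG" "h \<in> carrier ZG"
  shows "cls f = cls h \<longleftrightarrow> (\<exists>r. \<forall>x\<in>carrier G. f x = h x + r)"
proof -
  have "f \<ominus>\<^bsub>ZG\<^esub> h \<in> norm_ideal \<longleftrightarrow> (\<exists>r. \<forall>x\<in>carrier G. f x = h x + r)"
  proof
    assume "f \<ominus>\<^bsub>ZG\<^esub> h \<in> norm_ideal"
    then obtain r where r: "f \<ominus>\<^bsub>ZG\<^esub> h = (\<lambda>x\<in>carrier G. r)" by (auto simp: mem_norm_ideal)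
    have "f x = h x + r" if "x \<in> carrier G" for x
      using ZG_minus_apply[OF assms that] that by (simp add: r)
    then show "\<exists>r. \<forall>x\<in>carrier G. f x = h x + r" by blast
  next
    assume "\<exists>r. \<forall>x\<in>carrier G. f x = h x + r"
    then obtain r where "\<And>x. x \<in> carrier G \<Longrightarrow> f x = h x + r" by blast
    then show "f \<ominus>\<^bsub>ZG\<^esub> h \<in> norm_ideal"
      using assms by (intro norm_idealI[of _ r]) (auto simp: ZG_minus_apply)
  qed
  then show ?thesis
    using quot.cls_eq_iff[OF assms] by simp
qed

lemma cls_linear: "restrict cls (carrier ZG) \<in> linear_maps \<Z> ZG Q"
  by (auto simp: linear_maps_def quot.carrier_quotient quot.cls_add quot.cls_smult)

abbreviation "functionals \<equiv> linear_maps \<Z> Q (regular_module \<Z>)"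

lemma functionals_iff:
  "\<phi> \<in> functionals \<longleftrightarrow> \<phi> \<in> extensional (carrier Q) \<and>
    (\<forall>f\<in>carrier ZG. \<forall>h\<in>carrier ZG. \<phi> (cls (f \<oplus>\<^bsub>ZG\<^esub> h)) = \<phi> (cls f) + \<phi> (cls h)) \<and>
    (\<forall>r. \<forall>f\<in>carrier ZG. \<phi> (cls (r \<odot>\<^bsub>ZG\<^esub> f)) = r * \<phi> (cls f))"
  by (auto simp: linear_maps_def quot.carrier_quotient quot.cls_add quot.cls_smult PiE_iff
      regular_module_def)

text \<open>The functional with value \<open>w x\<close> at the class of \<open>x\<close>, evaluated on an arbitrary representative. It is
  well defined when the values of \<open>w\<close> sum to zero, since representatives differ by constants.\<close>

definition functional :: "('a \<Rightarrow> int) \<Rightarrow> ('a \<Rightarrow> int) set \<Rightarrow> int" where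
  "functional w = (\<lambda>C\<in>carrier Q.
    \<Sum>x\<in>carrier G. (SOME f. f \<in> carrier ZG \<and> cls f = C) x * w x)"

lemma functional_cls:
  assumes "aug w = 0" and f: "f \<in> carrier ZG"
  shows "functional w (cls f) = (\<Sum>x\<in>carrier G. f x * w x)"
proof -
  define h where "h = (SOME h. h \<in> carrier ZG \<and> cls h = cls f)"
  have h: "h \<in> carrier ZG \<and> cls h = cls f"
    unfolding h_def by (rule someI[of _ f]) (use f in simp)
  then obtain r where "\<And>x. x \<in> carrier G \<Longrightarrow> h x = f x + r"
    using cls_eq_iff[of h f] f by auto
  then have "(\<Sum>x\<in>carrier G. h x * w x) = (\<Sum>x\<in>carrier G. f x * w x) + r * aug w"
    by (simp add: aug_def sum_distrib_left sum.distrib distrib_right cong: sum.cong)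
  then show ?thesis
    using assms by (simp add: functional_def quot.carrier_quotient flip: h_def)
qed

lemma functional_mem:
  assumes "aug w = 0"
  shows "functional w \<in> functionals"
proof -
  have "functional w \<in> extensional (carrier Q)"
    by (simp add: functional_def)
  then show ?thesis
    unfolding functionals_iff
    by (auto simp: functional_cls[OF assms], auto simp: ZG_simps sum.distrib distrib_right
        sum_distrib_left mult.assoc)
qed

lemma functional_expand:
  assumes \<phi>: "\<phi> \<in> functionals" and f: "f \<in> carrier ZG"
  shows "\<phi> (cls f) = (\<Sum>x\<in>carrier G. f x * \<phi> (cls (\<delta> x)))"
proof -
  define \<psi> where "\<psi> = (\<lambda>f\<in>carrier ZG. \<phi> (cls f))"
  have \<psi>: "\<psi> \<in> linear_maps \<Z> ZG (regular_module \<Z>)"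
    using \<phi>[unfolded functionals_iff] by (auto simp: \<psi>_def linear_maps_def regular_module_def)
  have "f = (\<Oplus>\<^bsub>ZG\<^esub>x\<in>carrier G. f x \<odot>\<^bsub>ZG\<^esub> \<delta> x)"
    unfolding basis_combination[OF subset_refl] using f by (intro ZG_ext) (auto simp: carrier_ZG)
  then have "\<psi> f = (\<Sum>x\<in>carrier G. \<psi> (f x \<odot>\<^bsub>ZG\<^esub> \<delta> x))"
    using linear_maps_finsum[OF ZG.module_axioms regular_module_int(1) \<psi> fin,
        of "\<lambda>x. f x \<odot>\<^bsub>ZG\<^esub> \<delta> x"]
    by (simp add: regular_module_int(2))
  then show ?thesis
    using f \<phi> by (simp add: \<psi>_def functionals_iff)
qed

text \<open>A functional vanishes on the class of \<open>\<sigma>\<close>, which is zero.\<close>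

lemma functional_aug:
  assumes \<phi>: "\<phi> \<in> functionals"
  shows "aug (\<lambda>x. \<phi> (cls (\<delta> x))) = 0"
proof -
  let ?s = "\<lambda>x\<in>carrier G. 1 :: int" and ?z = "\<lambda>x\<in>carrier G. 0 :: int"
  have s: "?s \<in> carrier ZG" "?z \<in> carrier ZG" by (simp_all add: carrier_ZG)
  then have "cls ?s = cls ?z"
    by (auto simp: cls_eq_iff)
  then show ?thesis
    using functional_expand[OF \<phi> s(1)] functional_expand[OF \<phi> s(2)] by (simp add: aug_def)
qed

lemma functional_ext:
  assumes "\<phi> \<in> functionals" "\<psi> \<in> functionals"
    and "\<And>x. x \<in> carrier G \<Longrightarrow> \<phi> (cls (\<delta> x)) = \<psi> (cls (\<delta> x))"
  shows "\<phi> = \<psi>"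
proof (rule extensionalityI)
  show "\<phi> \<in> extensional (carrier Q)" "\<psi> \<in> extensional (carrier Q)"
    using assms(1,2) by (simp_all add: functionals_iff)
  show "\<phi> C = \<psi> C" if "C \<in> carrier Q" for C
    using that assms(3)
    by (auto simp: quot.carrier_quotient functional_expand[OF assms(1)] functional_expand[OF assms(2)]
        intro!: sum.cong)
qed

end

section \<open>A basis of the quotient\<close>

context finite_group
begin

text \<open>Subtracting the constant \<open>f(1)\<close> from a representative removes the coefficient of \<open>1\<close>, so the classes of
  the other group elements generate. They are pairwise distinct, so that a family of coefficients
  indexed by group elements becomes one indexed by classes.\<close>

lemma quotient_finitely_generated: "finitely_generated_module \<Z> Q"
proof -
  interpret Q: assoc_algebra \<Z> Q by (rule quot.quotient_assoc_algebra)
  define B where "B = carrier G - {\<one>}"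
  have B: "finite B" "B \<subseteq> carrier G" using fin by (auto simp: B_def)
  have inj: "inj_on (\<lambda>x. cls (\<delta> x)) B"
  proof (rule inj_onI)
    fix x y assume xy: "x \<in> B" "y \<in> B" "cls (\<delta> x) = cls (\<delta> y)"
    obtain r where r: "\<And>t. t \<in> carrier G \<Longrightarrow> \<delta> x t = \<delta> y t + r"
      using xy cls_eq_iff[of "\<delta> x" "\<delta> y"] by auto
    show "x = y"
      using r[of \<one>] r[of x] xy by (auto simp: B_def \<delta>_apply split: if_splits)
  qed
  show ?thesis
    unfolding finitely_generated_module_def
  proof (intro exI[of _ "(\<lambda>x. cls (\<delta> x)) ` B"] conjI ballI)
    show "finite ((\<lambda>x. cls (\<delta> x)) ` B)" using B by simp
    show "(\<lambda>x. cls (\<delta> x)) ` B \<subseteq> carrier Q" by (auto simp: quot.carrier_quotient)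
    fix C assume "C \<in> carrier Q"
    then obtain f where f: "f \<in> carrier ZG" "C = cls f" by (auto simp: quot.carrier_quotient)
    define h where "h = (\<Oplus>\<^bsub>ZG\<^esub>x\<in>B. (f x - f \<one>) \<odot>\<^bsub>ZG\<^esub> \<delta> x)"
    have h: "h \<in> carrier ZG" by (simp add: h_def)
    have "h = (\<lambda>t\<in>carrier G. if t \<in> B then f t - f \<one> else 0)"
      unfolding h_def by (rule basis_combination[OF B(2)])
    then have "\<exists>r. \<forall>t\<in>carrier G. f t = h t + r"
      by (intro exI[of _ "f \<one>"]) (auto simp: B_def)
    then have "C = cls h"
      using cls_eq_iff[OF f(1) h] f(2) by simp
    also have "\<dots> = (\<Oplus>\<^bsub>Q\<^esub>x\<in>B. restrict cls (carrier ZG) ((f x - f \<one>) \<odot>\<^bsub>ZG\<^esub> \<delta> x))"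
      using linear_maps_finsum[OF ZG.module_axioms Q.module_axioms cls_linear B(1),
          of "\<lambda>x. (f x - f \<one>) \<odot>\<^bsub>ZG\<^esub> \<delta> x"] h
      by (simp add: h_def)
    also have "\<dots> = (\<Oplus>\<^bsub>Q\<^esub>x\<in>B. (f x - f \<one>) \<odot>\<^bsub>Q\<^esub> cls (\<delta> x))"
      by (rule Q.M.finsum_cong') (auto simp: quot.cls_smult quot.carrier_quotient)
    also have "\<dots> = (\<Oplus>\<^bsub>Q\<^esub>x\<in>B. (f (the_inv_into B (\<lambda>x. cls (\<delta> x)) (cls (\<delta> x))) - f \<one>) \<odot>\<^bsub>Q\<^esub> cls (\<delta> x))"
      by (rule Q.M.finsum_cong')
        (auto simp: the_inv_into_f_f[OF inj] quot.cls_smult quot.carrier_quotient)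
    also have "\<dots> = (\<Oplus>\<^bsub>Q\<^esub>s\<in>(\<lambda>x. cls (\<delta> x)) ` B.
        (f (the_inv_into B (\<lambda>x. cls (\<delta> x)) s) - f \<one>) \<odot>\<^bsub>Q\<^esub> s)"
      by (subst Q.M.finsum_reindex[OF _ inj]) (auto simp: quot.cls_smult quot.carrier_quotient)
    finally show "\<exists>c\<in>(\<lambda>x. cls (\<delta> x)) ` B \<rightarrow> carrier \<Z>.
        C = (\<Oplus>\<^bsub>Q\<^esub>s\<in>(\<lambda>x. cls (\<delta> x)) ` B. c s \<odot>\<^bsub>Q\<^esub> s)"
      by (intro bexI[of _ "\<lambda>s. f (the_inv_into B (\<lambda>x. cls (\<delta> x)) s) - f \<one>"]) auto
  qed
qed

text \<open>The coordinates \<open>f(x) - f(1)\<close> for \<open>x \<noteq> 1\<close> are functionals, jointly injective and independent. The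
  index set of the free module has to consist of sets of functions, the type of the classes; the
  singletons of the basis elements serve for this.\<close>

lemma quotient_projective: "projective_module \<Z> Q"
proof -
  define B where "B = carrier G - {\<one>}"
  define e :: "'a \<Rightarrow> ('a \<Rightarrow> int) set" where "e x = {\<delta> x}" for x
  define S where "S = e ` B"
  have finS: "finite S" using fin by (simp add: S_def B_def)
  have inj: "inj_on e B"
  proof (rule inj_onI)
    fix x y assume "x \<in> B" "y \<in> B" "e x = e y"
    then show "x = y"
      using \<delta>_apply[of x x] \<delta>_apply[of x y] by (auto simp: B_def e_def split: if_splits)
  qed
  define coord where "coord x = functional (\<lambda>t. \<delta> x t - \<delta> \<one> t)" for x
  have aug0: "aug (\<lambda>t. \<delta> x t - \<delta> \<one> t) = 0" if "x \<in> B" for x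
    using that aug_\<delta>[of x] aug_\<delta>[of \<one>] by (simp add: aug_def B_def sum_subtractf)
  have coord: "coord x (cls f) = f x - f \<one>" if "x \<in> B" "f \<in> carrier ZG" for x f
  proof -
    have "(\<Sum>t\<in>carrier G. f t * (\<delta> x t - \<delta> \<one> t))
        = (\<Sum>t\<in>carrier G. (if t = x then f t else 0) - (if t = \<one> then f t else 0))"
      by (rule sum.cong) (auto simp: \<delta>_apply)
    then show ?thesis
      using that fin by (simp add: coord_def functional_cls aug0 sum_subtractf B_def)
  qed
  define F where "F C = (\<lambda>i\<in>S. coord (the_inv_into B e i) C)" for C
  have F: "F (cls f) (e x) = f x - f \<one>" if "x \<in> B" "f \<in> carrier ZG" for x f
    using that coord by (simp add: F_def S_def the_inv_into_f_f[OF inj])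
  have FS: "F C \<in> extensional S" for C by (simp add: F_def)
  have F_eqI: "u = v" if "u \<in> extensional S" "v \<in> extensional S"
    "\<And>x. x \<in> B \<Longrightarrow> u (e x) = v (e x)" for u v :: "('a \<Rightarrow> int) set \<Rightarrow> int"
    by (rule extensionalityI[OF that(1,2)]) (auto simp: S_def that(3))
  have car: "carrier (free_module \<Z> S) = extensional S"
    using finS by (auto simp: free_module_def PiE_def)
  have "restrict F (carrier Q) \<in> linear_maps \<Z> Q (free_module \<Z> S)"
    unfolding linear_maps_def
  proof (intro CollectI conjI ballI)
    show "restrict F (carrier Q) \<in> carrier Q \<rightarrow>\<^sub>E carrier (free_module \<Z> S)"
      by (auto simp: car FS)
  next
    fix C D assume "C \<in> carrier Q" "D \<in> carrier Q"
    then obtain f h where fh: "f \<in> carrier ZG" "C = cls f" "h \<in> carrier ZG" "D = cls h"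
      by (auto simp: quot.carrier_quotient)
    have "F (cls (f \<oplus>\<^bsub>ZG\<^esub> h)) = F C \<oplus>\<^bsub>free_module \<Z> S\<^esub> F D"
    proof (rule F_eqI[OF FS])
      show "F C \<oplus>\<^bsub>free_module \<Z> S\<^esub> F D \<in> extensional S" by (simp add: free_module_def)
      fix x assume x: "x \<in> B"
      then have "e x \<in> S" "x \<in> carrier G" by (simp_all add: S_def B_def)
      then show "F (cls (f \<oplus>\<^bsub>ZG\<^esub> h)) (e x) = (F C \<oplus>\<^bsub>free_module \<Z> S\<^esub> F D) (e x)"
        using x fh by (simp add: F free_module_def[of "\<Z>"]) (simp add: ZG_simps)
    qed
    then show "restrict F (carrier Q) (C \<oplus>\<^bsub>Q\<^esub> D)
        = restrict F (carrier Q) C \<oplus>\<^bsub>free_module \<Z> S\<^esub> restrict F (carrier Q) D"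
      using fh by (simp add: quot.cls_add quot.carrier_quotient)
  next
    fix r C assume "C \<in> carrier Q"
    then obtain f where f: "f \<in> carrier ZG" "C = cls f"
      by (auto simp: quot.carrier_quotient)
    have "F (cls (r \<odot>\<^bsub>ZG\<^esub> f)) = r \<odot>\<^bsub>free_module \<Z> S\<^esub> F C"
    proof (rule F_eqI[OF FS])
      show "r \<odot>\<^bsub>free_module \<Z> S\<^esub> F C \<in> extensional S" by (simp add: free_module_def)
      fix x assume x: "x \<in> B"
      then have "e x \<in> S" "x \<in> carrier G" by (simp_all add: S_def B_def)
      then show "F (cls (r \<odot>\<^bsub>ZG\<^esub> f)) (e x) = (r \<odot>\<^bsub>free_module \<Z> S\<^esub> F C) (e x)"
        using x f by (simp add: F free_module_def[of "\<Z>"]) (simp add: ZG_simps right_diff_distrib)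
    qed
    then show "restrict F (carrier Q) (r \<odot>\<^bsub>Q\<^esub> C)
        = r \<odot>\<^bsub>free_module \<Z> S\<^esub> restrict F (carrier Q) C"
      using f by (simp add: quot.cls_smult quot.carrier_quotient)
  qed
  moreover have "bij_betw (restrict F (carrier Q)) (carrier Q) (carrier (free_module \<Z> S))"
    unfolding bij_betw_def
  proof
    show "inj_on (restrict F (carrier Q)) (carrier Q)"
    proof (rule inj_onI)
      fix C D assume CD: "C \<in> carrier Q" "D \<in> carrier Q"
        "restrict F (carrier Q) C = restrict F (carrier Q) D"
      then obtain f h where fh: "f \<in> carrier ZG" "C = cls f" "h \<in> carrier ZG" "D = cls h"
        by (auto simp: quot.carrier_quotient)
      have "f x = h x + (f \<one> - h \<one>)" if "x \<in> carrier G" for x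
        using F[of x f] F[of x h] fh CD that by (cases "x = \<one>") (auto simp: B_def)
      then have "\<exists>r. \<forall>x\<in>carrier G. f x = h x + r"
        by blast
      then show "C = D"
        using cls_eq_iff[OF fh(1,3)] fh(2,4) by simp
    qed
    have "u \<in> F ` carrier Q" if u: "u \<in> extensional S" for u
    proof -
      define f where "f = (\<lambda>x\<in>carrier G. if x = \<one> then 0 else u (e x))"
      have f: "f \<in> carrier ZG" by (simp add: f_def carrier_ZG)
      have "F (cls f) = u"
        by (rule F_eqI[OF FS u]) (use F f in \<open>auto simp: f_def B_def\<close>)
      then show ?thesis
        using f by (auto simp: quot.carrier_quotient)
    qed
    then show "restrict F (carrier Q) ` carrier Q = carrier (free_module \<Z> S)"
      by (auto simp: car FS)
  qed
  ultimately have "module_isomorphic \<Z> Q (free_module \<Z> S)"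
    unfolding module_isomorphic_def by blast
  then show ?thesis
    by (rule projective_if_free[OF int_is_cring])
qed

end

section \<open>From the bimodule isomorphism to a central generator\<close>

context finite_group
begin

lemma dual_bimodule_simps:
  "carrier (dual_bimodule \<Z> Q) = functionals"
  "ring.add (dual_bimodule \<Z> Q) \<phi> \<psi> = (\<lambda>C\<in>carrier Q. \<phi> C + \<psi> C)"
  "lact (dual_bimodule \<Z> Q) C \<phi> = (\<lambda>D\<in>carrier Q. \<phi> (D \<otimes>\<^bsub>Q\<^esub> C))"
  "ract (dual_bimodule \<Z> Q) \<phi> C = (\<lambda>D\<in>carrier Q. \<phi> (C \<otimes>\<^bsub>Q\<^esub> D))"
  by (simp_all add: dual_bimodule_def)

lemma regular_bimodule_simps:
  "carrier (regular_bimodule Q) = carrier Q"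
  "ring.add (regular_bimodule Q) = ring.add Q"
  "lact (regular_bimodule Q) = monoid.mult Q"
  "ract (regular_bimodule Q) = monoid.mult Q"
  by (simp_all add: regular_bimodule_def)

lemma functional_\<delta>:
  assumes "aug w = 0" "x \<in> carrier G"
  shows "functional w (cls (\<delta> x)) = w x"
proof -
  have "(\<Sum>t\<in>carrier G. \<delta> x t * w t) = (\<Sum>t\<in>carrier G. if t = x then w t else 0)"
    by (rule sum.cong) (auto simp: \<delta>_apply)
  then show ?thesis
    using assms fin by (simp add: functional_cls)
qed

text \<open>The inverse in \<open>z(x) = c(x\<inverse>)\<close> turns the pairing \<open>\<Lambda>(xa) = \<Sum>a(y) c(xy)\<close> into a convolution,
  \<open>\<Lambda>(x\<inverse>a) = (az)(x)\<close>. A given \<open>u\<close> of augmentation zero is therefore a multiple of \<open>z\<close> as soon as the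
  functional \<open>x \<mapsto> u(x\<inverse>)\<close> is in the image of the isomorphism.\<close>

lemma cyclic_if_symmetric:
  assumes "bimodule_isomorphic Q (regular_bimodule Q) (dual_bimodule \<Z> Q)"
  shows "cyclic_group G"
proof -
  interpret Q: ring Q by (rule quot.quotient_ring)
  obtain \<Phi> where bij: "bij_betw \<Phi> (carrier Q) functionals"
    and lact: "\<And>C D. \<lbrakk>C \<in> carrier Q; D \<in> carrier Q\<rbrakk> \<Longrightarrow>
      \<Phi> (C \<otimes>\<^bsub>Q\<^esub> D) = (\<lambda>E\<in>carrier Q. \<Phi> D (E \<otimes>\<^bsub>Q\<^esub> C))"
    and ract: "\<And>C D. \<lbrakk>C \<in> carrier Q; D \<in> carrier Q\<rbrakk> \<Longrightarrow>
      \<Phi> (D \<otimes>\<^bsub>Q\<^esub> C) = (\<lambda>E\<in>carrier Q. \<Phi> D (C \<otimes>\<^bsub>Q\<^esub> E))"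
    using assms unfolding bimodule_isomorphic_def regular_bimodule_simps dual_bimodule_simps
    by blast
  define \<Lambda> where "\<Lambda> = \<Phi> \<one>\<^bsub>Q\<^esub>"
  have \<Lambda>: "\<Lambda> \<in> functionals"
    using bij_betwE[OF bij] by (simp add: \<Lambda>_def)
  have \<Phi>: "\<Phi> C D = \<Lambda> (D \<otimes>\<^bsub>Q\<^esub> C)" "\<Phi> C D = \<Lambda> (C \<otimes>\<^bsub>Q\<^esub> D)"
    if "C \<in> carrier Q" "D \<in> carrier Q" for C D
    using fun_cong[OF lact[of C "\<one>\<^bsub>Q\<^esub>"], of D] fun_cong[OF ract[of C "\<one>\<^bsub>Q\<^esub>"], of D] that
    by (simp_all add: \<Lambda>_def)
  define c where "c x = \<Lambda> (cls (\<delta> x))" for x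
  have c_comm: "c (x \<otimes> y) = c (y \<otimes> x)" if "x \<in> carrier G" "y \<in> carrier G" for x y
    using \<Phi>[of "cls (\<delta> x)" "cls (\<delta> y)"] that
    by (simp add: quot.carrier_quotient quot.cls_mult \<delta>_mult c_def)
  have aug_c: "aug c = 0"
    using functional_aug[OF \<Lambda>] by (simp add: aug_def c_def)
  have pairing: "\<Lambda> (cls f) = (\<Sum>t\<in>carrier G. f t * c t)" if "f \<in> carrier ZG" for f
    using functional_expand[OF \<Lambda> that] by (simp add: c_def)
  define z where "z = (\<lambda>x\<in>carrier G. c (inv x))"
  have "central_augmentation_generator G z"
  proof unfold_locales
    show "z \<in> carrier ZG" by (simp add: z_def carrier_ZG)
  next
    show "aug z = 0"
      using aug_c sum_inverse[of c] by (simp add: aug_def z_def)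
  next
    fix f assume f: "f \<in> carrier ZG"
    show "z \<otimes>\<^bsub>ZG\<^esub> f = f \<otimes>\<^bsub>ZG\<^esub> z"
    proof (rule ZG_ext)
      fix x assume x: "x \<in> carrier G"
      have "(z \<otimes>\<^bsub>ZG\<^esub> f) x = (\<Sum>y\<in>carrier G. c (y \<otimes> inv x) * f y)"
        using x by (simp add: ZG_mult_apply_right z_def inv_mult_group cong: sum.cong)
      also have "\<dots> = (\<Sum>y\<in>carrier G. f y * c (inv x \<otimes> y))"
        using x by (intro sum.cong) (simp_all add: c_comm)
      also have "\<dots> = (f \<otimes>\<^bsub>ZG\<^esub> z) x"
        using x by (simp add: ZG_mult z_def inv_mult_group cong: sum.cong)
      finally show "(z \<otimes>\<^bsub>ZG\<^esub> f) x = (f \<otimes>\<^bsub>ZG\<^esub> z) x" .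
    qed simp_all
  next
    fix u assume u: "u \<in> carrier ZG" "aug u = 0"
    define w where "w x = u (inv x)" for x
    have aug_w: "aug w = 0"
      using u sum_inverse[of u] by (simp add: w_def aug_def)
    obtain a where a: "a \<in> carrier ZG" "\<Phi> (cls a) = functional w"
    proof -
      have "functional w \<in> \<Phi> ` carrier Q"
        unfolding bij_betw_imp_surj_on[OF bij] by (rule functional_mem[OF aug_w])
      then show thesis
        using that by (auto simp: quot.carrier_quotient)
    qed
    have w: "w x = (\<Sum>y\<in>carrier G. a y * c (x \<otimes> y))" if x: "x \<in> carrier G" for x
    proof -
      have "w x = \<Lambda> (cls (\<delta> x) \<otimes>\<^bsub>Q\<^esub> cls a)"
        using \<Phi>(1)[of "cls a" "cls (\<delta> x)"] a x
        by (simp add: functional_\<delta>[OF aug_w] quot.carrier_quotient)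
      also have "\<dots> = (\<Sum>t\<in>carrier G. a (inv x \<otimes> t) * c t)"
        using a x by (simp add: quot.cls_mult pairing \<delta>_mult_apply cong: sum.cong)
      also have "\<dots> = (\<Sum>y\<in>carrier G. a y * c (x \<otimes> y))"
        using x sum_left_shift[OF x, of "\<lambda>t. a (inv x \<otimes> t) * c t"]
        by (simp add: inv_cancel cong: sum.cong)
      finally show ?thesis .
    qed
    have "u = a \<otimes>\<^bsub>ZG\<^esub> z"
    proof (rule ZG_ext[OF u(1)])
      fix x assume x: "x \<in> carrier G"
      have "u x = (\<Sum>y\<in>carrier G. a y * c (inv x \<otimes> y))"
        using w[of "inv x"] x by (simp add: w_def)
      also have "\<dots> = (a \<otimes>\<^bsub>ZG\<^esub> z) x"
        using x by (simp add: ZG_mult z_def inv_mult_group cong: sum.cong)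
      finally show "u x = (a \<otimes>\<^bsub>ZG\<^esub> z) x" .
    qed simp
    then show "\<exists>a\<in>carrier ZG. u = a \<otimes>\<^bsub>ZG\<^esub> z"
      using a by blast
  qed
  then show ?thesis
    by (rule central_augmentation_generator.cyclic)
qed

end

section \<open>The bimodule isomorphism for a cyclic group\<close>

context finite_group
begin

lemma cyclic_powers:
  assumes g: "g \<in> carrier G" and gen: "carrier G = range (\<lambda>n::int. g [^] n)"
  shows "bij_betw (\<lambda>k::nat. g [^] k) {..<ord g} (carrier G)"
  unfolding bij_betw_def
proof
  have eq: "g [^] k = g [^] l \<longleftrightarrow> int (ord g) dvd int l - int k" for k l :: nat
    using int_pow_eq[OF g, of "int k" "int l"] by (simp add: int_pow_int)
  show "inj_on (\<lambda>k::nat. g [^] k) {..<ord g}"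
  proof (rule inj_onI)
    fix k l assume "k \<in> {..<ord g}" "l \<in> {..<ord g}" "g [^] k = g [^] l"
    then have "int (ord g) dvd int k - int l" "k < ord g" "l < ord g"
      using eq[of l k] by simp_all
    then have "int k mod int (ord g) = int l mod int (ord g)" "k < ord g" "l < ord g"
      by (simp_all only: mod_eq_dvd_iff)
    then show "k = l"
      by (metis mod_less of_nat_eq_iff of_nat_mod)
  qed
  show "(\<lambda>k::nat. g [^] k) ` {..<ord g} = carrier G"
  proof
    show "carrier G \<subseteq> (\<lambda>k::nat. g [^] k) ` {..<ord g}"
    proof
      fix x assume "x \<in> carrier G"
      then obtain i :: int where i: "x = g [^] i" using gen by auto
      define k where "k = nat (i mod int (ord g))"
      have "ord g > 0" using ord_ge_1[OF fin g] by simp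
      then have k: "int k = i mod int (ord g)" "k < ord g"
        by (simp_all add: k_def nat_less_iff)
      have "x = g [^] int k"
        unfolding i int_pow_eq[OF g] k by (simp add: mod_eq_dvd_iff[symmetric])
      then show "x \<in> (\<lambda>k::nat. g [^] k) ` {..<ord g}"
        using k(2) by (auto simp: int_pow_int)
    qed
  qed (use g in auto)
qed

text \<open>Partial sums of \<open>w\<close> along the powers of \<open>g\<close> give \<open>a\<close>. The step from the last power back to \<open>1\<close> is
  consistent because the sum over the whole group vanishes.\<close>

lemma discrete_antiderivative:
  assumes g: "g \<in> carrier G" and gen: "carrier G = range (\<lambda>n::int. g [^] n)" and "aug w = 0"
  obtains a where "a \<in> carrier ZG" "\<And>y. y \<in> carrier G \<Longrightarrow> a y - a (y \<otimes> g) = w y"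
proof -
  let ?p = "\<lambda>k::nat. g [^] k"
  have bij: "bij_betw ?p {..<ord g} (carrier G)"
    by (rule cyclic_powers[OF g gen])
  define a where "a = (\<lambda>y\<in>carrier G. - (\<Sum>j<the_inv_into {..<ord g} ?p y. w (?p j)))"
  have a_pow: "a (?p k) = - (\<Sum>j<k. w (?p j))" if "k < ord g" for k
    using that g the_inv_into_f_f[OF bij_betw_imp_inj_on[OF bij], of k] by (simp add: a_def)
  have total: "(\<Sum>j\<in>{..<ord g}. w (?p j)) = 0"
    using sum.reindex_bij_betw[OF bij, of w] assms(3) by (simp add: aug_def)
  have pos: "ord g > 0" using ord_ge_1[OF fin g] by simp
  have "a y - a (y \<otimes> g) = w y" if y: "y \<in> carrier G" for y
  proof -
    obtain k where k: "k < ord g" "y = ?p k"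
      using y bij_betw_imp_surj_on[OF bij] by auto
    have "a (?p (Suc k)) = - (\<Sum>j<Suc k. w (?p j))"
    proof (cases "Suc k = ord g")
      case True
      have "?p (ord g) = ?p 0" using g by simp
      then have "a (?p (ord g)) = 0" using a_pow[OF pos] by simp
      then show ?thesis unfolding True total by simp
    next
      case False
      then show ?thesis using a_pow[of "Suc k"] k(1) by simp
    qed
    then show ?thesis
      using a_pow[OF k(1)] g k(2) by simp
  qed
  moreover have "a \<in> carrier ZG"
    by (simp add: a_def carrier_ZG)
  ultimately show thesis
    using that by blast
qed

text \<open>The pairing of \<open>f\<close> with the class of \<open>x\<close> is the difference of \<open>f\<close> between \<open>x\<inverse>\<close> and \<open>x\<inverse>g\<close>. Injectivity
  holds since only constants have zero differences, surjectivity by \<open>discrete_antiderivative\<close>.\<close>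

lemma symmetric_if_cyclic:
  assumes "cyclic_group G"
  shows "bimodule_isomorphic Q (regular_bimodule Q) (dual_bimodule \<Z> Q)"
proof -
  interpret Q: ring Q by (rule quot.quotient_ring)
  interpret comm_group G using assms by (rule cyclic_imp_abelian_group)
  obtain g where g: "g \<in> carrier G" and gen: "carrier G = range (\<lambda>n::int. g [^] n)"
    using assms by (auto simp: cyclic_group)
  define \<Lambda> where "\<Lambda> = functional (\<lambda>t. \<delta> \<one> t - \<delta> g t)"
  have aug0: "aug (\<lambda>t. \<delta> \<one> t - \<delta> g t) = 0"
    using aug_\<delta>[of \<one>] aug_\<delta>[OF g] by (simp add: aug_def sum_subtractf)
  have \<Lambda>_cls: "\<Lambda> (cls f) = f \<one> - f g" if "f \<in> carrier ZG" for f
  proof -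
    have "(\<Sum>t\<in>carrier G. f t * (\<delta> \<one> t - \<delta> g t))
        = (\<Sum>t\<in>carrier G. (if t = \<one> then f t else 0) - (if t = g then f t else 0))"
      by (rule sum.cong) (auto simp: \<delta>_apply)
    then show ?thesis
      using that fin g by (simp add: \<Lambda>_def functional_cls[OF aug0] sum_subtractf)
  qed
  have Q_comm: "C \<otimes>\<^bsub>Q\<^esub> D = D \<otimes>\<^bsub>Q\<^esub> C" if "C \<in> carrier Q" "D \<in> carrier Q" for C D
  proof -
    have "f \<otimes>\<^bsub>ZG\<^esub> h = h \<otimes>\<^bsub>ZG\<^esub> f" for f h
    proof (rule ZG_ext)
      fix x assume x: "x \<in> carrier G"
      have "(f \<otimes>\<^bsub>ZG\<^esub> h) x = (\<Sum>y\<in>carrier G. f (x \<otimes> inv y) * h y)"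
        by (rule ZG_mult_apply_right[OF x])
      also have "\<dots> = (\<Sum>y\<in>carrier G. h y * f (inv y \<otimes> x))"
        by (rule sum.cong) (simp_all add: m_comm[OF x])
      also have "\<dots> = (h \<otimes>\<^bsub>ZG\<^esub> f) x"
        using x by (simp add: ZG_mult)
      finally show "(f \<otimes>\<^bsub>ZG\<^esub> h) x = (h \<otimes>\<^bsub>ZG\<^esub> f) x" .
    qed simp_all
    then have "cls (f \<otimes>\<^bsub>ZG\<^esub> h) = cls (h \<otimes>\<^bsub>ZG\<^esub> f)" for f h
      by (rule arg_cong)
    with that show ?thesis
      by (auto simp only: quot.carrier_quotient quot.cls_mult)
  qed
  define \<Phi> where "\<Phi> C = (\<lambda>D\<in>carrier Q. \<Lambda> (D \<otimes>\<^bsub>Q\<^esub> C))" for C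
  have \<Phi>_mem: "\<Phi> C \<in> functionals" if "C \<in> carrier Q" for C
  proof -
    obtain f where f: "f \<in> carrier ZG" "C = cls f"
      using \<open>C \<in> carrier Q\<close> by (auto simp: quot.carrier_quotient)
    have "\<Phi> C \<in> extensional (carrier Q)" by (simp add: \<Phi>_def)
    moreover have "\<Phi> C (cls h) = (h \<otimes>\<^bsub>ZG\<^esub> f) \<one> - (h \<otimes>\<^bsub>ZG\<^esub> f) g" if "h \<in> carrier ZG" for h
      using that f by (simp add: \<Phi>_def quot.carrier_quotient quot.cls_mult \<Lambda>_cls)
    ultimately show ?thesis
      using f g unfolding functionals_iff
      by (auto simp: ZG.l_distr ZG.smult_assoc_left)
        (simp_all add: ZG_simps right_diff_distrib)
  qed
  have \<Phi>_\<delta>: "\<Phi> (cls f) (cls (\<delta> x)) = f (inv x) - f (inv x \<otimes> g)"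
    if "f \<in> carrier ZG" "x \<in> carrier G" for f x
    using that g by (simp add: \<Phi>_def quot.carrier_quotient quot.cls_mult \<Lambda>_cls \<delta>_mult_apply)
  have inj: "inj_on \<Phi> (carrier Q)"
  proof (rule inj_onI)
    fix C D assume CD: "C \<in> carrier Q" "D \<in> carrier Q" "\<Phi> C = \<Phi> D"
    then obtain f h where fh: "f \<in> carrier ZG" "C = cls f" "h \<in> carrier ZG" "D = cls h"
      by (auto simp: quot.carrier_quotient)
    have step: "f (y \<otimes> g) - h (y \<otimes> g) = f y - h y" if "y \<in> carrier G" for y
      using \<Phi>_\<delta>[OF fh(1), of "inv y"] \<Phi>_\<delta>[OF fh(3), of "inv y"] CD(3) fh that by simp
    have const: "f (g [^] k) - h (g [^] k) = f \<one> - h \<one>" for k :: nat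
      by (induction k) (use g step in auto)
    have "f y = h y + (f \<one> - h \<one>)" if "y \<in> carrier G" for y
    proof -
      have "y \<in> (\<lambda>k::nat. g [^] k) ` {..<ord g}"
        using that cyclic_powers[OF g gen] by (simp add: bij_betw_def)
      then obtain k :: nat where "y = g [^] k" by blast
      then show ?thesis using const[of k] by simp
    qed
    then show "C = D"
      using cls_eq_iff[OF fh(1,3)] fh(2,4) by blast
  qed
  have surj: "\<phi> \<in> \<Phi> ` carrier Q" if \<phi>: "\<phi> \<in> functionals" for \<phi>
  proof -
    have "aug (\<lambda>x. \<phi> (cls (\<delta> (inv x)))) = 0"
      using functional_aug[OF \<phi>] sum_inverse[of "\<lambda>x. \<phi> (cls (\<delta> x))"] by (simp add: aug_def)
    from discrete_antiderivative[OF g gen this] obtain a where a: "a \<in> carrier ZG"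
      "\<And>y. y \<in> carrier G \<Longrightarrow> a y - a (y \<otimes> g) = \<phi> (cls (\<delta> (inv y)))"
      by blast
    have C: "cls a \<in> carrier Q"
      using a by (simp add: quot.carrier_quotient)
    have "\<phi> = \<Phi> (cls a)"
      by (rule functional_ext[OF \<phi> \<Phi>_mem[OF C]]) (simp add: \<Phi>_\<delta> a)
    then show ?thesis using C by blast
  qed
  have "bij_betw \<Phi> (carrier Q) functionals"
    unfolding bij_betw_def using inj surj \<Phi>_mem by blast
  moreover have "\<Phi> (C \<oplus>\<^bsub>Q\<^esub> D) = (\<lambda>E\<in>carrier Q. \<Phi> C E + \<Phi> D E)"
    if "C \<in> carrier Q" "D \<in> carrier Q" for C D
  proof -
    have "\<Lambda> (C' \<oplus>\<^bsub>Q\<^esub> D') = \<Lambda> C' + \<Lambda> D'" if "C' \<in> carrier Q" "D' \<in> carrier Q" for C' D'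
      using that functional_mem[OF aug0]
      by (auto simp: \<Lambda>_def functionals_iff quot.carrier_quotient quot.cls_add)
    then show ?thesis
      using that by (auto simp: \<Phi>_def Q.r_distr)
  qed
  moreover have "\<Phi> (C \<otimes>\<^bsub>Q\<^esub> D) = (\<lambda>E\<in>carrier Q. \<Phi> D (E \<otimes>\<^bsub>Q\<^esub> C))"
    if "C \<in> carrier Q" "D \<in> carrier Q" for C D
    using that by (auto simp: \<Phi>_def Q.m_assoc)
  moreover have "\<Phi> (D \<otimes>\<^bsub>Q\<^esub> C) = (\<lambda>E\<in>carrier Q. \<Phi> D (C \<otimes>\<^bsub>Q\<^esub> E))"
    if "C \<in> carrier Q" "D \<in> carrier Q" for C D
  proof -
    have "E \<otimes>\<^bsub>Q\<^esub> (D \<otimes>\<^bsub>Q\<^esub> C) = C \<otimes>\<^bsub>Q\<^esub> E \<otimes>\<^bsub>Q\<^esub> D" if E: "E \<in> carrier Q" for E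
      using Q_comm[of "E \<otimes>\<^bsub>Q\<^esub> D" C] E \<open>C \<in> carrier Q\<close> \<open>D \<in> carrier Q\<close> by (simp add: Q.m_assoc)
    then show ?thesis
      using that by (auto simp: \<Phi>_def)
  qed
  ultimately show ?thesis
    unfolding bimodule_isomorphic_def regular_bimodule_simps dual_bimodule_simps by blast
qed

end

section \<open>Symmetry is equivalent to cyclicity\<close>

theorem corollary1p10:
  fixes G :: "('g, 'e) monoid_scheme"
  assumes "group G" and "finite (carrier G)"
  shows "symmetric_algebra \<Z>
      (quotient_algebra (group_algebra \<Z> G)
        (scalar_multiples \<Z> (group_algebra \<Z> G) (group_sum \<Z> G)))
    \<longleftrightarrow> cyclic_group G"
proof -
  interpret finite_group G
    using assms by (intro finite_group.intro finite_group_axioms.intro)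
  show ?thesis
    unfolding symmetric_algebra_def
    using quot.quotient_assoc_algebra quotient_finitely_generated quotient_projective
      cyclic_if_symmetric symmetric_if_cyclic
    by blast
qed

end
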